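(* Let $X$ be a sofic shift with generalized left Fischer cover $(G,\mathcal{L}_G)$ and left Krieger cover $(K,\mathcal{L}_K)$. Then $(G,\mathcal{L}_G)$ is a foundation of $(K,\mathcal{L}_K)$, and no smaller subgraph is a foundation, i.e. no proper labelled subgraph of $(G,\mathcal{L}_G)$ is a foundation of $(K,\mathcal{L}_K)$.
   Context: A shift space is a closed subset $X\subseteq\mathcal{A}^{\mathbb{Z}}$ ($\mathcal{A}$ a finite discrete alphabet, product topology) invariant under the shift $\sigma(x)_i=x_{i+1}$. It is sofic if it is the image of a shift of finite type under a continuous shift-commuting map. $X^+=\{x_0x_1x_2\cdots : x\in X\}$ and $X^-=\{\cdots x_{-2}x_{-1} : x\in X\}$. For $x^+\in X^+$, $P_\infty(x^+)=\{y^-\in X^- : y^-x^+\in X\}$. Covers. The left Krieger cover $(K,\mathcal{L}_K)$ of $X$ is the labelled directed graph with vertex set $K^0=\{P_\infty(x^+) : x^+\in X^+\}$ (finite since $X$ is sofic) which has an edge labelled $a\in\mathcal{A}$ from $P$ to $P'$ if and only if there is $x^+\in X^+$ with $ax^+\in X^+$, $P=P_\infty(ax^+)$ and $P'=P_\infty(x^+)$. For vertices, $u\geq v$ means that there is a path (possibly of length $0$) from $u$ to $v$. A vertex $P\in K^0$ is non-decomposable if whenever $V\subseteq K^0$ and $P=\bigcup_{Q\in V}Q$, then $P\in V$. The generalized left Fischer cover $(G,\mathcal{L}_G)$ of $X$ is the labelled subgraph of $(K,\mathcal{L}_K)$ with vertex set $G^0=\{P\in K^0 : P\geq P' \text{ for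 some non-decomposable } P'\in K^0\}$ and all edges with both endpoints in $G^0$. Foundations. A labelled graph $\mathcal{E}=(E,\mathcal{L})$ is left-resolving if no vertex receives two edges with the same label, and predecessor-separated if distinct vertices $u\neq v$ have $P^E_\infty(u)\neq P^E_\infty(v)$, where $P^E_\infty(v)$ is the set of label sequences of left-infinite paths terminating at $v$. Let $\mathcal{E}$ be finite, left-resolving and predecessor-separated. For $V\subseteq E^0$ and $a\in\mathcal{A}$ let $aV$ be the set of sources of edges labelled $a$ terminating in $V$. Let $S$ be a set of nonempty subsets of $E^0$ and $\sim$ an equivalence relation on $S$. $(S,\sim)$ is past closed if for all $u,v\in E^0$, $U,V\in S$, $a\in\mathcal{A}$: (1) $\{v\}\in S$; (2) $\{u\}\sim\{v\}$ implies $u=v$; (3) $aV\neq\emptyset$ implies $aV\in S$; (4) $U\sim V$ and $aU\neq\emptyset$ imply $aV\neq\emptyset$ and $aU\sim aV$. For $(S,\sim)$ past closed, $\mathcal{G}(\mathcal{E},S,\sim)$ is the labelled graph with vertex set $S/{\sim}$ which has an edge labelled $a$ from $[aV]$ to $[V]$ whenever $aV\neq\emptyset$ ($[V]$ is the $\sim$-class of $V\in S$). $\mathcal{E}$ is a foundation of a labelled graph $\mathcal{H}$ if $\mathcal{H}$ is labelled graph isomorphic to $\mathcal{G}(\mathcal{E},S,\sim)$ for some past closed $(S,\sim)$. *)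

theory Defs
  imports
    "HOL-Analysis.Function_Topology"
    "Graph_Theory.Digraph_Isomorphism"
begin

section \<open>Shift spaces\<close>

definition full_shift :: "'a set \<Rightarrow> (int \<Rightarrow> 'a) topology" where
  "full_shift A = product_topology (\<lambda>_. discrete_topology A) UNIV"

definition shift :: "(int \<Rightarrow> 'a) \<Rightarrow> (int \<Rightarrow> 'a)" where
  "shift x = (\<lambda>i. x (i + 1))"

definition shift_space :: "'a set \<Rightarrow> (int \<Rightarrow> 'a) set \<Rightarrow> bool" where
  "shift_space A X \<longleftrightarrow> finite A \<and> closedin (full_shift A) X \<and> shift ` X = X"

text \<open>The points over a finite alphabet \<open>B\<close> in which no word of a finite set \<open>F\<close> occurs.\<close>

definition shift_of_finite_type :: "'b set \<Rightarrow> (int \<Rightarrow> 'b) set \<Rightarrow> bool" where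
  "shift_of_finite_type B Y \<longleftrightarrow> finite B \<and>
     (\<exists>F. finite F \<and> F \<subseteq> lists B \<and>
        Y = {y. range y \<subseteq> B \<and> (\<forall>w\<in>F. \<forall>i. map (\<lambda>k. y (i + int k)) [0..<length w] \<noteq> w)})"

definition factor_map ::
    "'b set \<Rightarrow> (int \<Rightarrow> 'b) set \<Rightarrow> 'a set \<Rightarrow> ((int \<Rightarrow> 'b) \<Rightarrow> (int \<Rightarrow> 'a)) \<Rightarrow> bool" where
  "factor_map B Y A \<phi> \<longleftrightarrow>
     continuous_map (subtopology (full_shift B) Y) (full_shift A) \<phi> \<and>
     (\<forall>y\<in>Y. \<phi> (shift y) = shift (\<phi> y))"

text \<open>A definition cannot quantify over the type of the letters of the covering shift of finite
  type, so these letters are natural numbers. This is no restriction, see \<open>soficI\<close> below.\<close>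

definition sofic :: "'a set \<Rightarrow> (int \<Rightarrow> 'a) set \<Rightarrow> bool" where
  "sofic A X \<longleftrightarrow> shift_space A X \<and>
     (\<exists>(B :: nat set) Y \<phi>. shift_of_finite_type B Y \<and> factor_map B Y A \<phi> \<and> X = \<phi> ` Y)"

lemma shift_of_finite_type_recode:
  assumes Y: "shift_of_finite_type B Y" and f: "inj_on f B"
  shows "shift_of_finite_type (f ` B) ((\<lambda>y. f \<circ> y) ` Y)"
proof -
  obtain F where F: "finite B" "finite F" "F \<subseteq> lists B"
    and Yeq: "Y = {y. range y \<subseteq> B \<and> (\<forall>w\<in>F. \<forall>i. map (\<lambda>k. y (i + int k)) [0..<length w] \<noteq> w)}"
    using Y unfolding shift_of_finite_type_def by blast
  have occ: "map (\<lambda>k. (f \<circ> y) (i + int k)) [0..<length (map f w)] = map f w \<longleftrightarrow>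
             map (\<lambda>k. y (i + int k)) [0..<length w] = w"
    if "range y \<subseteq> B" "w \<in> F" for y w i
  proof -
    have w: "set w \<subseteq> B" using F(3) that by auto
    have "map (\<lambda>k. (f \<circ> y) (i + int k)) [0..<length (map f w)] =
          map f (map (\<lambda>k. y (i + int k)) [0..<length w])"
      by simp
    moreover have "inj_on f (set (map (\<lambda>k. y (i + int k)) [0..<length w]) \<union> set w)"
      using f by (rule inj_on_subset) (use that w in auto)
    ultimately show ?thesis by (metis inj_on_map_eq_map)
  qed
  have "(\<lambda>y. f \<circ> y) ` Y = {z. range z \<subseteq> f ` B \<and>
          (\<forall>w\<in>map f ` F. \<forall>i. map (\<lambda>k. z (i + int k)) [0..<length w] \<noteq> w)}" (is "_ = ?R")
  proof
    show "(\<lambda>y. f \<circ> y) ` Y \<subseteq> ?R"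
    proof
      fix z assume "z \<in> (\<lambda>y. f \<circ> y) ` Y"
      then obtain y where y: "y \<in> Y" "z = f \<circ> y" by auto
      then show "z \<in> ?R" using occ[of y] unfolding Yeq by fastforce
    qed
    show "?R \<subseteq> (\<lambda>y. f \<circ> y) ` Y"
    proof
      fix z assume z: "z \<in> ?R"
      define y where "y = inv_into B f \<circ> z"
      have r: "range y \<subseteq> B" using z unfolding y_def by (auto intro!: inv_into_into)
      have zy: "z = f \<circ> y"
      proof
        fix i
        have "z i \<in> f ` B" using z by blast
        then show "z i = (f \<circ> y) i" by (simp add: y_def f_inv_into_f)
      qed
      have "y \<in> Y" unfolding Yeq using occ[OF r] z r zy by blast
      then show "z \<in> (\<lambda>y. f \<circ> y) ` Y" using zy by blast
    qed
  qed
  moreover have "map f ` F \<subseteq> lists (f ` B)" using F(3) by (fastforce simp: in_lists_conv_set)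
  ultimately show ?thesis unfolding shift_of_finite_type_def using F by blast
qed

lemma continuous_map_recode:
  assumes "g ` C \<subseteq> B"
  shows "continuous_map (full_shift C) (full_shift B) (\<lambda>y. g \<circ> y)"
proof -
  have "continuous_map (full_shift C) (discrete_topology B) (\<lambda>y. g (y i))" for i
  proof -
    have "continuous_map (discrete_topology C) (discrete_topology B) g"
      using assms by auto
    moreover have "continuous_map (full_shift C) (discrete_topology C) (\<lambda>y. y i)"
      unfolding full_shift_def by (rule continuous_map_product_projection) simp
    ultimately show ?thesis
      using continuous_map_compose[of _ _ "\<lambda>y. y i" _ g] by (simp add: o_def)
  qed
  then show ?thesis
    unfolding full_shift_def[of B] continuous_map_componentwise_UNIV by (simp add: o_def)
qed

lemma soficI:
  fixes B :: "'b set" and A :: "'a set"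
  assumes X: "shift_space A X"
    and Y: "shift_of_finite_type B Y" and fac: "factor_map B Y A \<phi>" and XY: "X = \<phi> ` Y"
  shows "sofic A X"
proof -
  have finB: "finite B" and rY: "\<And>y. y \<in> Y \<Longrightarrow> range y \<subseteq> B"
    using Y by (auto simp: shift_of_finite_type_def)
  obtain f :: "'b \<Rightarrow> nat" where f: "inj_on f B"
    using finite_imp_inj_to_nat_seg[OF finB] by blast
  define g where "g = inv_into B f"
  define Z where "Z = (\<lambda>y. f \<circ> y) ` Y"
  define \<psi> where "\<psi> = (\<lambda>z. \<phi> (g \<circ> z))"
  have decode: "g \<circ> (f \<circ> y) = y" if "y \<in> Y" for y
    using rY[OF that] f by (auto simp: g_def fun_eq_iff image_subset_iff)
  have "continuous_map (full_shift (f ` B)) (full_shift B) (\<lambda>z. g \<circ> z)"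
    by (rule continuous_map_recode) (auto simp: g_def f)
  then have "continuous_map (subtopology (full_shift (f ` B)) Z) (subtopology (full_shift B) Y)
               (\<lambda>z. g \<circ> z)"
    by (auto simp: continuous_map_in_subtopology Z_def decode
             intro: continuous_map_from_subtopology)
  then have "continuous_map (subtopology (full_shift (f ` B)) Z) (full_shift A) \<psi>"
    using fac continuous_map_compose[of _ _ "\<lambda>z. g \<circ> z" _ \<phi>]
    unfolding factor_map_def \<psi>_def by (auto simp: o_def)
  moreover have "\<psi> (shift z) = shift (\<psi> z)" if z: "z \<in> Z" for z
  proof -
    obtain y where y: "y \<in> Y" "z = f \<circ> y" using z unfolding Z_def by blast
    have "g \<circ> shift z = shift (g \<circ> z)" by (simp add: shift_def fun_eq_iff)
    then show ?thesis using y fac by (simp add: \<psi>_def decode factor_map_def)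
  qed
  ultimately have "factor_map (f ` B) Z A \<psi>" by (simp add: factor_map_def)
  moreover have "shift_of_finite_type (f ` B) Z"
    unfolding Z_def by (rule shift_of_finite_type_recode[OF Y f])
  moreover have "X = \<psi> ` Z"
    by (simp add: XY Z_def \<psi>_def image_image decode)
  ultimately show ?thesis using X unfolding sofic_def by blast
qed

text \<open>A left ray \<open>\<dots> y\<^bsub>-2\<^esub> y\<^bsub>-1\<^esub>\<close> is stored from right to left as a function on the natural
  numbers: the value at \<open>n\<close> is the letter at position \<open>-1 - n\<close>.\<close>

definition right_rays :: "(int \<Rightarrow> 'a) set \<Rightarrow> (nat \<Rightarrow> 'a) set" where
  "right_rays X = {(\<lambda>n. x (int n)) |x. x \<in> X}"

definition left_rays :: "(int \<Rightarrow> 'a) set \<Rightarrow> (nat \<Rightarrow> 'a) set" where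
  "left_rays X = {(\<lambda>n. x (- 1 - int n)) |x. x \<in> X}"

definition glue :: "(nat \<Rightarrow> 'a) \<Rightarrow> (nat \<Rightarrow> 'a) \<Rightarrow> (int \<Rightarrow> 'a)" where
  "glue y x = (\<lambda>i. if i < 0 then y (nat (- 1 - i)) else x (nat i))"

definition pasts :: "(int \<Rightarrow> 'a) set \<Rightarrow> (nat \<Rightarrow> 'a) \<Rightarrow> (nat \<Rightarrow> 'a) set" where
  "pasts X x = {y \<in> left_rays X. glue y x \<in> X}"

section \<open>Labelled graphs and foundations\<close>

text \<open>A labelled graph is given by a directed graph \<open>E\<close> and a labelling \<open>L\<close> of its arcs; values of
  \<open>L\<close> outside \<open>arcs E\<close> are irrelevant.\<close>

definition left_resolving :: "('v, 'e) pre_digraph \<Rightarrow> ('e \<Rightarrow> 'a) \<Rightarrow> bool" where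
  "left_resolving E L \<longleftrightarrow>
     (\<forall>e\<in>arcs E. \<forall>f\<in>arcs E. head E e = head E f \<and> L e = L f \<longrightarrow> e = f)"

text \<open>In a left-infinite path the arcs are also numbered from right to left, \<open>p 0\<close> being the last.\<close>

definition vertex_pasts :: "('v, 'e) pre_digraph \<Rightarrow> ('e \<Rightarrow> 'a) \<Rightarrow> 'v \<Rightarrow> (nat \<Rightarrow> 'a) set" where
  "vertex_pasts E L v =
     {(\<lambda>n. L (p n)) |p. (\<forall>n. p n \<in> arcs E) \<and> head E (p 0) = v \<and>
                          (\<forall>n. head E (p (Suc n)) = tail E (p n))}"

definition predecessor_separated :: "('v, 'e) pre_digraph \<Rightarrow> ('e \<Rightarrow> 'a) \<Rightarrow> bool" where
  "predecessor_separated E L \<longleftrightarrow>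
     (\<forall>u\<in>verts E. \<forall>v\<in>verts E. u \<noteq> v \<longrightarrow> vertex_pasts E L u \<noteq> vertex_pasts E L v)"

definition labelled_graph_iso ::
    "('v, 'e) pre_digraph \<Rightarrow> ('e \<Rightarrow> 'a) \<Rightarrow> ('w, 'f) pre_digraph \<Rightarrow> ('f \<Rightarrow> 'a) \<Rightarrow> bool" where
  "labelled_graph_iso E L F M \<longleftrightarrow>
     (\<exists>h. pre_digraph.digraph_isomorphism E h \<and> F = app_iso h E \<and>
          (\<forall>e\<in>arcs E. M (iso_arcs h e) = L e))"

definition labelled_subgraph ::
    "('v, 'e) pre_digraph \<Rightarrow> ('e \<Rightarrow> 'a) \<Rightarrow> ('v, 'e) pre_digraph \<Rightarrow> ('e \<Rightarrow> 'a) \<Rightarrow> bool" where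
  "labelled_subgraph H M E L \<longleftrightarrow> subgraph H E \<and> (\<forall>e\<in>arcs H. M e = L e)"

text \<open>The set \<open>aV\<close> of sources of arcs with label \<open>a\<close> and range in \<open>V\<close>.\<close>

definition label_pre :: "('v, 'e) pre_digraph \<Rightarrow> ('e \<Rightarrow> 'a) \<Rightarrow> 'a \<Rightarrow> 'v set \<Rightarrow> 'v set" where
  "label_pre E L a V = tail E ` {e \<in> arcs E. L e = a \<and> head E e \<in> V}"

definition past_closed ::
    "('v, 'e) pre_digraph \<Rightarrow> ('e \<Rightarrow> 'a) \<Rightarrow> 'v set set \<Rightarrow> ('v set \<times> 'v set) set \<Rightarrow> bool" where
  "past_closed E L S R \<longleftrightarrow>
     S \<subseteq> Pow (verts E) - {{}} \<and> equiv S R \<and>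
     (\<forall>v\<in>verts E. {v} \<in> S) \<and>
     (\<forall>u\<in>verts E. \<forall>v\<in>verts E. ({u}, {v}) \<in> R \<longrightarrow> u = v) \<and>
     (\<forall>V\<in>S. \<forall>a. label_pre E L a V \<noteq> {} \<longrightarrow> label_pre E L a V \<in> S) \<and>
     (\<forall>U\<in>S. \<forall>V\<in>S. \<forall>a. (U, V) \<in> R \<and> label_pre E L a U \<noteq> {} \<longrightarrow>
        label_pre E L a V \<noteq> {} \<and> (label_pre E L a U, label_pre E L a V) \<in> R)"

text \<open>In the graphs built below there is at most one arc with given source, label and range, so an
  arc is simply the triple of these data.\<close>

definition triple_graph :: "'v set \<Rightarrow> ('v \<times> 'a \<times> 'v) set \<Rightarrow> ('v, 'v \<times> 'a \<times> 'v) pre_digraph" where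
  "triple_graph V T = \<lparr>verts = V, arcs = T, tail = (\<lambda>(u, a, v). u), head = (\<lambda>(u, a, v). v)\<rparr>"

definition triple_label :: "'v \<times> 'a \<times> 'v \<Rightarrow> 'a" where
  "triple_label = (\<lambda>(u, a, v). a)"

text \<open>The graph \<open>\<G>(E, S, R)\<close>; its labelling is \<open>triple_label\<close>.\<close>

definition class_graph ::
    "('v, 'e) pre_digraph \<Rightarrow> ('e \<Rightarrow> 'a) \<Rightarrow> 'v set set \<Rightarrow> ('v set \<times> 'v set) set \<Rightarrow>
     ('v set set, 'v set set \<times> 'a \<times> 'v set set) pre_digraph" where
  "class_graph E L S R = triple_graph (S // R)
     {(R `` {label_pre E L a V}, a, R `` {V}) |a V. V \<in> S \<and> label_pre E L a V \<noteq> {}}"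

definition foundation ::
    "('v, 'e) pre_digraph \<Rightarrow> ('e \<Rightarrow> 'a) \<Rightarrow> ('w, 'f) pre_digraph \<Rightarrow> ('f \<Rightarrow> 'a) \<Rightarrow> bool" where
  "foundation E L H M \<longleftrightarrow>
     fin_digraph E \<and> left_resolving E L \<and> predecessor_separated E L \<and>
     (\<exists>S R. past_closed E L S R \<and> labelled_graph_iso H M (class_graph E L S R) triple_label)"

section \<open>Left Krieger cover and generalized left Fischer cover\<close>

text \<open>Both covers are labelled by \<open>triple_label\<close>. The ray \<open>ax\<close> is \<open>case_nat a x\<close>.\<close>

definition Krieger_vertices :: "(int \<Rightarrow> 'a) set \<Rightarrow> (nat \<Rightarrow> 'a) set set" where
  "Krieger_vertices X = pasts X ` right_rays X"

definition left_Krieger_cover ::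
    "(int \<Rightarrow> 'a) set \<Rightarrow>
     ((nat \<Rightarrow> 'a) set, (nat \<Rightarrow> 'a) set \<times> 'a \<times> (nat \<Rightarrow> 'a) set) pre_digraph" where
  "left_Krieger_cover X = triple_graph (Krieger_vertices X)
     {(pasts X (case_nat a x), a, pasts X x) |a x. x \<in> right_rays X \<and> case_nat a x \<in> right_rays X}"

definition non_decomposable :: "(int \<Rightarrow> 'a) set \<Rightarrow> (nat \<Rightarrow> 'a) set \<Rightarrow> bool" where
  "non_decomposable X P \<longleftrightarrow>
     P \<in> Krieger_vertices X \<and> (\<forall>V \<subseteq> Krieger_vertices X. P = \<Union> V \<longrightarrow> P \<in> V)"

definition generalized_left_Fischer_cover ::
    "(int \<Rightarrow> 'a) set \<Rightarrow>
     ((nat \<Rightarrow> 'a) set, (nat \<Rightarrow> 'a) set \<times> 'a \<times> (nat \<Rightarrow> 'a) set) pre_digraph" where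
  "generalized_left_Fischer_cover X = left_Krieger_cover X \<restriction>
     {P \<in> Krieger_vertices X.
        \<exists>P'. non_decomposable X P' \<and> P \<rightarrow>\<^sup>*\<^bsub>left_Krieger_cover X\<^esub> P'}"

end

theory Submission
  imports Defs
begin

text \<open>Everything rests on one operation on sets \<open>P\<close> of left rays: \<open>letter_pre a P\<close>, the rays that land in
  \<open>P\<close> when the letter \<open>a\<close> is appended. The pasts of \<open>ax\<close> are \<open>letter_pre a\<close> of the pasts of \<open>x\<close>, so the
  left Krieger cover has one arc labelled \<open>a\<close> into \<open>P\<close>, from \<open>letter_pre a P\<close>, whenever that set is
  nonempty, and nothing about \<open>X\<close> matters beyond its finite family of pasts. The family is finite since
  \<open>X\<close> is sofic (\<open>finite_Krieger_vertices\<close>), and its members are closed since \<open>X\<close> is. By closedness the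
  left-infinite paths ending at the vertex \<open>P\<close> carry precisely the label sequences in \<open>P\<close>
  (\<open>vertex_pasts_past_cover\<close>). The generalized left Fischer cover arises in the same way from the
  vertices that lead to a non-decomposable one, a subfamily closed under \<open>letter_pre\<close>.

  It is a foundation because every past is a union of non-decomposable ones, and \<open>letter_pre\<close> commutes
  with unions: a set of Fischer vertices can represent the Krieger vertex that is its union
  (\<open>foundation_past_cover\<close>).

  Let now a subgraph \<open>H\<close> of the Fischer cover be a foundation. A class graph over \<open>H\<close> has at the class of \<open>V\<close>
  the union of the pasts that the vertices of \<open>V\<close> have in \<open>H\<close> (\<open>vertex_pasts_class_graph\<close>, a compactness
  argument). So sending a vertex of \<open>H\<close> to its pasts in \<open>H\<close> gives a map from the vertices of \<open>H\<close> to
  Krieger vertices such that every Krieger vertex is a union of values; its image contains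
  all non-decomposable vertices and is closed under predecessors, so it contains all Fischer
  vertices. Counting makes it a permutation of them, and since passing to a subgraph only shrinks
  pasts, it is the identity and \<open>H\<close> has lost neither a vertex nor an arc
  (\<open>foundation_subgraph_of_core_eq\<close>).\<close>

section \<open>Neighbourhoods in the full shift\<close>

definition agree :: "nat \<Rightarrow> (int \<Rightarrow> 'a) \<Rightarrow> (int \<Rightarrow> 'a) \<Rightarrow> bool" where
  "agree n x y \<longleftrightarrow> (\<forall>i. \<bar>i\<bar> \<le> int n \<longrightarrow> x i = y i)"

lemma agree_refl: "agree n x x"
  by (simp add: agree_def)

lemma agree_trans: "agree n x y \<Longrightarrow> agree n y z \<Longrightarrow> agree n x z"
  by (simp add: agree_def)

lemma agree_mono: "agree n x y \<Longrightarrow> m \<le> n \<Longrightarrow> agree m x y"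
  by (simp add: agree_def)

lemma topspace_full_shift: "topspace (full_shift A) = {z. range z \<subseteq> A}"
  by (auto simp: full_shift_def PiE_def Pi_def)

text \<open>The sets of points agreeing with a given point on a central window are the basic neighbourhoods
  of that point, so that open and closed sets can be handled by comparing finitely many coordinates.\<close>

lemma openin_full_shift:
  "openin (full_shift A) U \<longleftrightarrow>
     (\<forall>z\<in>U. range z \<subseteq> A \<and> (\<exists>n. \<forall>z'. range z' \<subseteq> A \<and> agree n z z' \<longrightarrow> z' \<in> U))" (is "?L \<longleftrightarrow> ?R")
proof
  assume L: ?L
  show ?R
  proof
    fix z assume z: "z \<in> U"
    then have "range z \<subseteq> A"
      using openin_subset[OF L] by (auto simp: topspace_full_shift)
    moreover obtain W where W: "finite {i. W i \<noteq> A}" "z \<in> PiE UNIV W" "PiE UNIV W \<subseteq> U"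
    proof -
      obtain W where "finite {i \<in> UNIV. W i \<noteq> topspace (discrete_topology A)}"
        "z \<in> PiE UNIV W" "PiE UNIV W \<subseteq> U"
        using L z unfolding full_shift_def openin_product_topology_alt by blast
      then show ?thesis using that by simp
    qed
    have "finite ((\<lambda>i. nat \<bar>i\<bar>) ` {i. W i \<noteq> A})" using W(1) by simp
    then obtain n where n: "\<And>i. W i \<noteq> A \<Longrightarrow> nat \<bar>i\<bar> \<le> n"
      unfolding finite_nat_set_iff_bounded_le by blast
    have "z' \<in> U" if z': "range z' \<subseteq> A" "agree n z z'" for z'
    proof -
      have "z' i \<in> W i" for i
      proof (cases "W i = A")
        case True
        then show ?thesis using z'(1) by blast
      next
        case False
        have "z i \<in> W i" using W(2) by (rule PiE_mem) simp
        moreover have "z i = z' i" using z'(2) n[OF False] by (simp add: agree_def)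
        ultimately show ?thesis by simp
      qed
      then have "z' \<in> PiE UNIV W" by (simp add: PiE_iff)
      then show ?thesis using W(3) by blast
    qed
    ultimately show "range z \<subseteq> A \<and> (\<exists>n. \<forall>z'. range z' \<subseteq> A \<and> agree n z z' \<longrightarrow> z' \<in> U)"
      by blast
  qed
next
  assume R: ?R
  show ?L
    unfolding full_shift_def openin_product_topology_alt
  proof
    fix z assume z: "z \<in> U"
    have r: "range z \<subseteq> A" using R z by simp
    obtain n where n: "\<And>z'. range z' \<subseteq> A \<Longrightarrow> agree n z z' \<Longrightarrow> z' \<in> U"
      using bspec[OF R z] by metis
    define W where "W i = (if \<bar>i\<bar> \<le> int n then {z i} else A)" for i
    have "{i \<in> UNIV. W i \<noteq> topspace (discrete_topology A)} \<subseteq> {- int n..int n}"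
      by (auto simp: W_def split: if_splits)
    then have "finite {i \<in> UNIV. W i \<noteq> topspace (discrete_topology A)}"
      by (rule finite_subset) simp
    moreover have "\<forall>i\<in>UNIV. openin (discrete_topology A) (W i)" "z \<in> PiE UNIV W"
      using r by (auto simp: W_def)
    moreover have "PiE UNIV W \<subseteq> U"
    proof
      fix z' assume z': "z' \<in> PiE UNIV W"
      have *: "z' i \<in> W i" for i using z' by auto
      show "z' \<in> U"
      proof (rule n)
        have "W i \<subseteq> A" for i using r by (auto simp: W_def)
        then show "range z' \<subseteq> A" using * by blast
        show "agree n z z'" unfolding agree_def
        proof (intro allI impI)
          fix i :: int assume "\<bar>i\<bar> \<le> int n"
          then show "z i = z' i" using *[of i] by (simp add: W_def)
        qed
      qed
    qed
    ultimately show "\<exists>W. finite {i \<in> UNIV. W i \<noteq> topspace (discrete_topology A)} \<and>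
        (\<forall>i\<in>UNIV. openin (discrete_topology A) (W i)) \<and> z \<in> PiE UNIV W \<and> PiE UNIV W \<subseteq> U"
      by blast
  qed
qed

lemma closedin_full_shift:
  "closedin (full_shift A) C \<longleftrightarrow>
     (\<forall>z\<in>C. range z \<subseteq> A) \<and> (\<forall>z. range z \<subseteq> A \<and> (\<forall>n. \<exists>z'\<in>C. agree n z z') \<longrightarrow> z \<in> C)"
  (is "_ \<longleftrightarrow> ?sub \<and> ?lim")
proof -
  have "(\<exists>n. \<forall>z'. range z' \<subseteq> A \<and> agree n z z' \<longrightarrow> z' \<in> {z. range z \<subseteq> A} - C) \<longleftrightarrow>
          \<not> (\<forall>n. \<exists>z'\<in>C. agree n z z')" if ?sub for z
  proof -
    have "(\<forall>z'. range z' \<subseteq> A \<and> agree n z z' \<longrightarrow> z' \<in> {z. range z \<subseteq> A} - C) \<longleftrightarrow>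
          \<not> (\<exists>z'\<in>C. agree n z z')" for n
      using that by auto
    then show ?thesis by simp
  qed
  then have "openin (full_shift A) ({z. range z \<subseteq> A} - C) \<longleftrightarrow> ?lim" if ?sub
    unfolding openin_full_shift using that by (simp add: Ball_def) metis
  moreover have "C \<subseteq> {z. range z \<subseteq> A} \<longleftrightarrow> ?sub" by (simp add: subset_eq)
  ultimately show ?thesis
    unfolding closedin_def topspace_full_shift by (metis (no_types, lifting))
qed

lemma closedin_full_shift_range: "closedin (full_shift A) C \<Longrightarrow> z \<in> C \<Longrightarrow> range z \<subseteq> A"
  using closedin_subset[of "full_shift A" C] by (auto simp: topspace_full_shift)

lemma closedin_full_shift_limit:
  assumes "closedin (full_shift A) C" "range z \<subseteq> A" "\<And>n. \<exists>z'\<in>C. agree n z z'"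
  shows "z \<in> C"
proof -
  have "\<forall>z. range z \<subseteq> A \<and> (\<forall>n. \<exists>z'\<in>C. agree n z z') \<longrightarrow> z \<in> C"
    using assms(1) unfolding closedin_full_shift by (rule conjunct2)
  from spec[OF this, of z] show ?thesis using assms(2,3) by simp
qed

lemma closed_limit:
  assumes "shift_space A X" "\<And>n. \<exists>z'\<in>X. agree n z z'"
  shows "z \<in> X"
proof -
  have cl: "closedin (full_shift A) X" using assms(1) by (simp add: shift_space_def)
  have "z i \<in> A" for i
  proof -
    obtain z' where "z' \<in> X" "agree (nat \<bar>i\<bar>) z z'" using assms(2) by blast
    then show ?thesis using closedin_full_shift_range[OF cl, of z'] by (auto simp: agree_def)
  qed
  then have "range z \<subseteq> A" by blast
  from closedin_full_shift_limit[OF cl this assms(2)] show ?thesis .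
qed

lemma closedin_shift_of_finite_type:
  assumes "shift_of_finite_type B Y"
  shows "closedin (full_shift B) Y"
proof -
  obtain F where Y: "Y = {y. range y \<subseteq> B \<and>
      (\<forall>w\<in>F. \<forall>i. map (\<lambda>k. y (i + int k)) [0..<length w] \<noteq> w)}"
    using assms unfolding shift_of_finite_type_def by blast
  have "z \<in> Y" if r: "range z \<subseteq> B" and lim: "\<And>n. \<exists>z'\<in>Y. agree n z z'" for z
  proof -
    have "map (\<lambda>k. z (i + int k)) [0..<length w] \<noteq> w" if w: "w \<in> F" for w i
    proof -
      obtain z' where z': "z' \<in> Y" "agree (nat \<bar>i\<bar> + length w) z z'" using lim by blast
      have eq: "map (\<lambda>k. z (i + int k)) [0..<length w] = map (\<lambda>k. z' (i + int k)) [0..<length w]"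
        using z'(2) by (auto simp: agree_def)
      show ?thesis unfolding eq using z'(1) w unfolding Y by simp
    qed
    then show ?thesis using r unfolding Y by blast
  qed
  moreover have "\<forall>z\<in>Y. range z \<subseteq> B" unfolding Y by simp
  ultimately show ?thesis unfolding closedin_full_shift by simp
qed

section \<open>A sofic shift has finitely many pasts\<close>

text \<open>The Curtis--Hedlund--Lyndon argument: the coordinate at \<open>0\<close> of \<open>\<phi> z\<close> is locally constant in \<open>z\<close>,
  and by compactness of \<open>Y\<close> finitely many of the neighbourhoods on which it is constant suffice.\<close>

lemma window_of_continuous_map:
  assumes "finite B" "closedin (full_shift B) Y"
    and cont: "continuous_map (subtopology (full_shift B) Y) (full_shift A) \<phi>"
  shows "\<exists>m. \<forall>z\<in>Y. \<forall>z'\<in>Y. agree m z z' \<longrightarrow> \<phi> z 0 = \<phi> z' 0"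
proof -
  have YB: "Y \<subseteq> {z. range z \<subseteq> B}"
    using closedin_full_shift_range[OF assms(2)] by blast
  have cmp: "compactin (full_shift B) Y"
    using assms(1,2) by (intro closedin_compact_space)
      (auto simp: full_shift_def compact_space_product_topology compact_space_discrete_topology)
  have top: "topspace (subtopology (full_shift B) Y) = Y"
    using YB by (auto simp: topspace_full_shift)
  have coord: "continuous_map (subtopology (full_shift B) Y) (discrete_topology A) (\<lambda>z. \<phi> z 0)"
    using cont unfolding full_shift_def[of A] continuous_map_componentwise_UNIV by blast
  have "\<exists>n. \<forall>z\<in>Y. agree n c z \<longrightarrow> \<phi> z 0 = \<phi> c 0" if c: "c \<in> Y" for c
  proof -
    have "\<phi> c 0 \<in> A"
      using coord c top by (auto simp: continuous_map_def)
    then have "openin (subtopology (full_shift B) Y) {z \<in> Y. \<phi> z 0 \<in> {\<phi> c 0}}"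
      using openin_continuous_map_preimage[OF coord, of "{\<phi> c 0}"] unfolding top by simp
    then obtain T where T: "openin (full_shift B) T" "{z \<in> Y. \<phi> z 0 \<in> {\<phi> c 0}} = T \<inter> Y"
      unfolding openin_subtopology by blast
    then have "c \<in> T" using c by blast
    then obtain n where n: "\<And>z. range z \<subseteq> B \<Longrightarrow> agree n c z \<Longrightarrow> z \<in> T"
      using bspec[OF T(1)[unfolded openin_full_shift], of c] by metis
    have "\<phi> z 0 = \<phi> c 0" if z: "z \<in> Y" "agree n c z" for z
    proof -
      have "z \<in> T \<inter> Y" using n[of z] z YB by blast
      then show ?thesis unfolding T(2)[symmetric] by simp
    qed
    then show ?thesis by blast
  qed
  then obtain n where n: "\<And>c z. c \<in> Y \<Longrightarrow> z \<in> Y \<Longrightarrow> agree (n c) c z \<Longrightarrow> \<phi> z 0 = \<phi> c 0"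
    by metis
  define V where "V c = {z. range z \<subseteq> B \<and> agree (n c) c z}" for c
  have op: "openin (full_shift B) (V c)" for c
    unfolding openin_full_shift V_def by (auto intro: agree_trans)
  have "Y \<subseteq> \<Union> (V ` Y)"
    using YB by (auto simp: V_def intro: agree_refl)
  then obtain \<F> where \<F>: "finite \<F>" "\<F> \<subseteq> V ` Y" "Y \<subseteq> \<Union> \<F>"
    using compactinD[OF cmp, of "V ` Y"] op by blast
  then obtain C where C: "C \<subseteq> Y" "finite C" "Y \<subseteq> \<Union> (V ` C)"
    using finite_subset_image[of \<F> V Y] by blast
  \<comment> \<open>The sum of the finitely many radii \<open>n c\<close> bounds each of them.\<close>
  have "\<phi> z 0 = \<phi> z' 0" if zz': "z \<in> Y" "z' \<in> Y" "agree (\<Sum>c\<in>C. n c) z z'" for z z'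
  proof -
    obtain c where c: "c \<in> C" "z \<in> V c" using C zz' by blast
    have "agree (n c) z z'"
      using zz'(3) c(1) C(2) by (auto intro!: agree_mono[OF zz'(3)] member_le_sum)
    moreover have "agree (n c) c z" using c(2) by (simp add: V_def)
    ultimately have "agree (n c) c z'" by (rule agree_trans[rotated])
    then show ?thesis
      using n[of c z] n[of c z'] \<open>agree (n c) c z\<close> c(1) C(1) zz' by (metis subsetD)
  qed
  then show ?thesis by blast
qed

definition shift_by :: "int \<Rightarrow> (int \<Rightarrow> 'a) \<Rightarrow> (int \<Rightarrow> 'a)" where
  "shift_by k z = (\<lambda>i. z (i + k))"

lemma shift_by_mem_shift_of_finite_type:
  assumes "shift_of_finite_type B Y" "y \<in> Y"
  shows "shift_by k y \<in> Y"
proof -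
  obtain F where Y: "Y = {y. range y \<subseteq> B \<and>
      (\<forall>w\<in>F. \<forall>i. map (\<lambda>k. y (i + int k)) [0..<length w] \<noteq> w)}"
    using assms(1) unfolding shift_of_finite_type_def by blast
  have "map (\<lambda>j. shift_by k y (i + int j)) [0..<length w] \<noteq> w" if "w \<in> F" for w i
  proof -
    have "map (\<lambda>j. y (i + k + int j)) [0..<length w] \<noteq> w"
      using assms(2) that unfolding Y by simp
    then show ?thesis by (simp add: shift_by_def ac_simps)
  qed
  moreover have "range (shift_by k y) \<subseteq> B"
    using assms(2) unfolding Y shift_by_def by auto
  ultimately show ?thesis unfolding Y by simp
qed

lemma factor_map_shift_by:
  fixes B :: "'b set" and A :: "'a set"
  assumes Y: "shift_of_finite_type B Y" and fac: "factor_map B Y A \<phi>" and y: "y \<in> Y"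
  shows "\<phi> (shift_by k y) = shift_by k (\<phi> y)"
proof -
  have pos: "\<phi> (shift_by (int n) y) = shift_by (int n) (\<phi> y)" if "y \<in> Y" for n y
  proof (induction n)
    case 0
    then show ?case by (simp add: shift_by_def)
  next
    case (Suc n)
    have "shift_by (int (Suc n)) z = shift (shift_by (int n) z)" for z :: "int \<Rightarrow> 'a"
      by (simp add: shift_by_def shift_def ac_simps)
    moreover have "shift_by (int (Suc n)) z = shift (shift_by (int n) z)" for z :: "int \<Rightarrow> 'b"
      by (simp add: shift_by_def shift_def ac_simps)
    moreover have "\<phi> (shift (shift_by (int n) y)) = shift (\<phi> (shift_by (int n) y))"
      using fac shift_by_mem_shift_of_finite_type[OF Y that, of "int n"]
      by (simp add: factor_map_def)
    ultimately show ?case using Suc by (simp only:)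
  qed
  show ?thesis
  proof (cases "k \<ge> 0")
    case True
    then show ?thesis using pos[OF y, of "nat k"] by simp
  next
    case False
    define u where "u = shift_by k y"
    have "u \<in> Y" unfolding u_def by (rule shift_by_mem_shift_of_finite_type[OF Y y])
    from pos[OF this, of "nat (- k)"] False
    have "\<phi> (shift_by (- k) u) = shift_by (- k) (\<phi> u)" by simp
    moreover have "shift_by (- k) u = y" by (simp add: u_def shift_by_def)
    ultimately have "\<phi> y = shift_by (- k) (\<phi> u)" by simp
    then have "shift_by k (\<phi> y) = \<phi> u" by (simp add: shift_by_def)
    then show ?thesis by (simp add: u_def)
  qed
qed

text \<open>A forbidden word is no longer than \<open>c\<close>. An occurrence of it in the spliced point that starts inside
  the window of agreement or to the right of it lies in \<open>z'\<close>; one that starts further left ends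
  before coordinate \<open>0\<close> and lies in \<open>z\<close>.\<close>

lemma splice_mem_shift_of_finite_type:
  assumes "shift_of_finite_type B Y"
  shows "\<exists>c. \<forall>n\<ge>c. \<forall>z\<in>Y. \<forall>z'\<in>Y. agree n z z' \<longrightarrow> (\<lambda>i. if i < 0 then z i else z' i) \<in> Y"
proof -
  obtain F where F: "finite F" and Y: "Y = {y. range y \<subseteq> B \<and>
      (\<forall>w\<in>F. \<forall>i. map (\<lambda>k. y (i + int k)) [0..<length w] \<noteq> w)}"
    using assms unfolding shift_of_finite_type_def by blast
  define c where "c = (\<Sum>w\<in>F. length w)"
  have len: "length w \<le> c" if "w \<in> F" for w
    unfolding c_def using F that by (intro member_le_sum) auto
  have "(\<lambda>i. if i < 0 then z i else z' i) \<in> Y" (is "?s \<in> Y")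
    if z: "z \<in> Y" "z' \<in> Y" "agree n z z'" and n: "c \<le> n" for z z' n
  proof -
    have "map (\<lambda>k. ?s (i + int k)) [0..<length w] \<noteq> w" if w: "w \<in> F" for w i
    proof (cases "i < - int n")
      case True
      then have eq: "map (\<lambda>k. ?s (i + int k)) [0..<length w] = map (\<lambda>k. z (i + int k)) [0..<length w]"
        using len[OF w] n by auto
      show ?thesis unfolding eq using z(1) w unfolding Y by simp
    next
      case False
      then have eq: "map (\<lambda>k. ?s (i + int k)) [0..<length w] = map (\<lambda>k. z' (i + int k)) [0..<length w]"
        using z(3) by (auto simp: agree_def)
      show ?thesis unfolding eq using z(2) w unfolding Y by simp
    qed
    moreover have "range ?s \<subseteq> B"
      using z(1,2) unfolding Y by auto
    ultimately show ?thesis unfolding Y by simp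
  qed
  then show ?thesis by blast
qed

text \<open>Whether a left ray and a right ray fit together to a point of \<open>X\<close> is decided by a window of bounded
  size in the covering shift of finite type: if \<open>z\<close> produces the left ray, \<open>z'\<close> produces the right ray
  and both have the same window, then the point spliced from \<open>z\<close> and \<open>z'\<close> produces both. So the
  pasts of \<open>x\<close> depend only on the set of windows that produce \<open>x\<close>, and there are finitely many such
  sets.\<close>

lemma finite_Krieger_vertices:
  assumes "sofic A X"
  shows "finite (Krieger_vertices X)"
proof -
  obtain B :: "nat set" and Y \<phi>
    where Y: "shift_of_finite_type B Y" and fac: "factor_map B Y A \<phi>" and X: "X = \<phi> ` Y"
    using assms unfolding sofic_def by blast
  have finB: "finite B" and YB: "\<And>y. y \<in> Y \<Longrightarrow> range y \<subseteq> B"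
    using Y unfolding shift_of_finite_type_def by auto
  obtain m where m: "\<And>z z'. z \<in> Y \<Longrightarrow> z' \<in> Y \<Longrightarrow> agree m z z' \<Longrightarrow> \<phi> z 0 = \<phi> z' 0"
    using window_of_continuous_map[OF finB closedin_shift_of_finite_type[OF Y]
        conjunct1[OF fac[unfolded factor_map_def]]] by metis
  obtain c0 where c0: "\<And>n z z'. c0 \<le> n \<Longrightarrow> z \<in> Y \<Longrightarrow> z' \<in> Y \<Longrightarrow> agree n z z' \<Longrightarrow>
      (\<lambda>i. if i < 0 then z i else z' i) \<in> Y"
    using splice_mem_shift_of_finite_type[OF Y] by blast
  \<comment> \<open>At this radius splicing stays in \<open>Y\<close>, and the image letter at \<open>i < 0\<close> sees only the part taken
    from \<open>z\<close> or shared with it, the one at \<open>i \<ge> 0\<close> only the part taken from \<open>z'\<close> or shared.\<close>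
  define c where "c = max c0 m"
  have at: "\<phi> z i = \<phi> z' i"
    if "z \<in> Y" "z' \<in> Y" "\<And>j. \<bar>j - i\<bar> \<le> int m \<Longrightarrow> z j = z' j" for z z' i
  proof -
    have "\<phi> (shift_by i z) 0 = \<phi> (shift_by i z') 0"
      by (rule m) (use that shift_by_mem_shift_of_finite_type[OF Y] in \<open>auto simp: agree_def shift_by_def\<close>)
    then show ?thesis using that factor_map_shift_by[OF Y fac] by (simp add: shift_by_def)
  qed
  define window where "window z = restrict z {- int c..int c}" for z :: "int \<Rightarrow> nat"
  have agr: "agree c z z' \<longleftrightarrow> window z = window z'" for z z'
  proof -
    have "agree c z z' \<longleftrightarrow> (\<forall>i\<in>{- int c..int c}. z i = z' i)"
      unfolding agree_def by (meson abs_le_iff atLeastAtMost_iff minus_le_iff)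
    also have "\<dots> \<longleftrightarrow> window z = window z'"
    proof
      assume "\<forall>i\<in>{- int c..int c}. z i = z' i"
      then show "window z = window z'" unfolding window_def by (intro restrict_ext) blast
    next
      assume "window z = window z'"
      then have "window z i = window z' i" for i by (rule fun_cong)
      then show "\<forall>i\<in>{- int c..int c}. z i = z' i"
        unfolding window_def by (metis restrict_apply')
    qed
    finally show ?thesis .
  qed
  define left where "left w = {(\<lambda>n. \<phi> z (- 1 - int n)) |z. z \<in> Y \<and> window z = w}" for w
  define right where "right x = window ` {z \<in> Y. \<forall>n. \<phi> z (int n) = x n}" for x
  have dec: "pasts X x = \<Union> (left ` right x)" for x
  proof
    show "pasts X x \<subseteq> \<Union> (left ` right x)"
    proof
      fix y assume "y \<in> pasts X x"
      then obtain z where z: "z \<in> Y" "glue y x = \<phi> z" unfolding pasts_def X by blast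
      have "\<phi> z (int n) = x n" "\<phi> z (- 1 - int n) = y n" for n
        unfolding z(2)[symmetric] by (simp_all add: glue_def)
      then have "y = (\<lambda>n. \<phi> z (- 1 - int n))" by simp
      then have "y \<in> left (window z)" using z(1) unfolding left_def by blast
      moreover have "window z \<in> right x"
        using z(1) \<open>\<And>n. \<phi> z (int n) = x n\<close> unfolding right_def by simp
      ultimately show "y \<in> \<Union> (left ` right x)" by blast
    qed
    show "\<Union> (left ` right x) \<subseteq> pasts X x"
    proof
      fix y assume "y \<in> \<Union> (left ` right x)"
      then obtain z z' where z: "z \<in> Y" "z' \<in> Y" "window z = window z'"
        and y: "y = (\<lambda>n. \<phi> z (- 1 - int n))" and x: "\<And>n. \<phi> z' (int n) = x n"
        unfolding left_def right_def by blast
      define s where "s = (\<lambda>i. if i < 0 then z i else z' i)"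
      have ag: "agree c z z'" using z(3) agr by blast
      have s: "s \<in> Y" unfolding s_def by (rule c0[of c]) (use z ag in \<open>auto simp: c_def\<close>)
      have "\<phi> s = glue y x"
      proof
        fix i
        show "\<phi> s i = glue y x i"
        proof (cases "i < 0")
          case True
          have "\<phi> s i = \<phi> z i"
            by (rule at) (use s z ag True in \<open>auto simp: s_def agree_def c_def\<close>)
          then show ?thesis using True by (simp add: glue_def y)
        next
          case False
          have "\<phi> s i = \<phi> z' i"
            by (rule at) (use s z ag False in \<open>auto simp: s_def agree_def c_def\<close>)
          then show ?thesis using False x[of "nat i"] by (simp add: glue_def)
        qed
      qed
      moreover have "y \<in> left_rays X" using z(1) by (auto simp: left_rays_def y X)
      ultimately show "y \<in> pasts X x" using s unfolding pasts_def X
        by (metis (mono_tags, lifting) image_eqI mem_Collect_eq)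
    qed
  qed
  have "right x \<subseteq> PiE {- int c..int c} (\<lambda>_. B)" for x
  proof
    fix w assume "w \<in> right x"
    then obtain z where "w = window z" "range z \<subseteq> B" using YB unfolding right_def by blast
    then show "w \<in> PiE {- int c..int c} (\<lambda>_. B)" by (auto simp: window_def)
  qed
  then have "Krieger_vertices X \<subseteq> (\<lambda>W. \<Union> (left ` W)) ` Pow (PiE {- int c..int c} (\<lambda>_. B))"
    unfolding Krieger_vertices_def dec by blast
  moreover have "finite (PiE {- int c..int c} (\<lambda>_. B))"
    using finB by (intro finite_PiE) auto
  ultimately show ?thesis by (meson finite_Pow_iff finite_imageI finite_subset)
qed

section \<open>The Krieger cover is determined by its vertices\<close>

text \<open>The left rays that land in \<open>P\<close> once the letter \<open>a\<close> is appended at their right end: because rays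
  are stored from right to left, the new letter becomes the value at \<open>0\<close>.\<close>

definition letter_pre :: "'a \<Rightarrow> (nat \<Rightarrow> 'a) set \<Rightarrow> (nat \<Rightarrow> 'a) set" where
  "letter_pre a P = {y. case_nat a y \<in> P}"

lemma letter_pre_Union: "letter_pre a (\<Union> V) = (\<Union>P\<in>V. letter_pre a P)"
  by (auto simp: letter_pre_def)

lemma shift_space_shift_mem_iff:
  fixes X :: "(int \<Rightarrow> 'a) set"
  assumes "shift_space A X"
  shows "shift z \<in> X \<longleftrightarrow> z \<in> X"
proof -
  have "inj (shift :: (int \<Rightarrow> 'a) \<Rightarrow> int \<Rightarrow> 'a)"
  proof (rule injI)
    fix x y :: "int \<Rightarrow> 'a"
    assume "shift x = shift y"
    then have "shift x (i - 1) = shift y (i - 1)" for i by simp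
    then have "x i = y i" for i by (simp add: shift_def)
    then show "x = y" by (rule ext)
  qed
  moreover have "shift ` X = X" using assms by (simp add: shift_space_def)
  ultimately show ?thesis by (metis inj_image_mem_iff)
qed

lemma glue_case_nat: "glue (case_nat a y) x = shift (glue y (case_nat a x))"
proof
  fix i :: int
  consider "i < - 1" | "i = - 1" | "i \<ge> 0" by linarith
  then show "glue (case_nat a y) x i = shift (glue y (case_nat a x)) i"
  proof cases
    case 1
    then have "nat (- 1 - i) = Suc (nat (- 1 - (i + 1)))" by simp
    then show ?thesis using 1 by (simp add: glue_def shift_def)
  next
    case 2
    then show ?thesis by (simp add: glue_def shift_def)
  next
    case 3
    then have "nat (i + 1) = Suc (nat i)" by simp
    then show ?thesis using 3 by (simp add: glue_def shift_def)
  qed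
qed

lemma mem_pasts_iff: "y \<in> pasts X x \<longleftrightarrow> glue y x \<in> X"
proof -
  have "y \<in> left_rays X" if "glue y x \<in> X"
  proof -
    have "y = (\<lambda>n. glue y x (- 1 - int n))" by (simp add: glue_def)
    then show ?thesis using that unfolding left_rays_def by blast
  qed
  then show ?thesis by (auto simp: pasts_def)
qed

lemma pasts_nonempty_iff: "pasts X x \<noteq> {} \<longleftrightarrow> x \<in> right_rays X"
proof
  assume "pasts X x \<noteq> {}"
  then obtain y where "glue y x \<in> X" using mem_pasts_iff by blast
  moreover have "x = (\<lambda>n. glue y x (int n))" by (simp add: glue_def)
  ultimately show "x \<in> right_rays X" unfolding right_rays_def by blast
next
  assume "x \<in> right_rays X"
  then obtain z where z: "z \<in> X" "x = (\<lambda>n. z (int n))" unfolding right_rays_def by blast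
  have "glue (\<lambda>n. z (- 1 - int n)) x = z"
    by (auto simp: glue_def z(2) fun_eq_iff)
  then show "pasts X x \<noteq> {}" using z(1) mem_pasts_iff by (metis empty_iff)
qed

lemma pasts_case_nat:
  assumes "shift_space A X"
  shows "pasts X (case_nat a x) = letter_pre a (pasts X x)"
  by (auto simp: letter_pre_def mem_pasts_iff glue_case_nat shift_space_shift_mem_iff[OF assms])

lemma Krieger_vertex_nonempty: "P \<in> Krieger_vertices X \<Longrightarrow> P \<noteq> {}"
  unfolding Krieger_vertices_def using pasts_nonempty_iff by blast

lemma Krieger_vertices_letter_pre:
  assumes "shift_space A X" "P \<in> Krieger_vertices X" "letter_pre a P \<noteq> {}"
  shows "letter_pre a P \<in> Krieger_vertices X"
proof -
  obtain x where x: "P = pasts X x" using assms(2) unfolding Krieger_vertices_def by blast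
  have "letter_pre a P = pasts X (case_nat a x)" unfolding x pasts_case_nat[OF assms(1)] ..
  then show ?thesis
    using assms(3) pasts_nonempty_iff[of X "case_nat a x"] unfolding Krieger_vertices_def by simp
qed

text \<open>The labelled graph that a family of pasts determines; for the family of all pasts of a shift space
  it is the left Krieger cover.\<close>

definition past_cover ::
    "(nat \<Rightarrow> 'a) set set \<Rightarrow>
     ((nat \<Rightarrow> 'a) set, (nat \<Rightarrow> 'a) set \<times> 'a \<times> (nat \<Rightarrow> 'a) set) pre_digraph" where
  "past_cover \<P> = triple_graph \<P> {(letter_pre a P, a, P) |a P. P \<in> \<P> \<and> letter_pre a P \<noteq> {}}"

lemma past_cover_simps [simp]:
  "verts (past_cover \<P>) = \<P>"
  "tail (past_cover \<P>) = (\<lambda>(u, a, v). u)"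
  "head (past_cover \<P>) = (\<lambda>(u, a, v). v)"
  by (simp_all add: past_cover_def triple_graph_def)

lemma arcs_past_cover:
  "arcs (past_cover \<P>) = {(letter_pre a P, a, P) |a P. P \<in> \<P> \<and> letter_pre a P \<noteq> {}}"
  by (simp add: past_cover_def triple_graph_def)

text \<open>The source of an arc is a function of its range and its label, so the Krieger cover can be
  recovered from its vertex set alone.\<close>

lemma left_Krieger_cover_eq:
  assumes "shift_space A X"
  shows "left_Krieger_cover X = past_cover (Krieger_vertices X)"
proof -
  have "{(pasts X (case_nat a x), a, pasts X x) |a x.
           x \<in> right_rays X \<and> case_nat a x \<in> right_rays X} =
        {(letter_pre a P, a, P) |a P. P \<in> Krieger_vertices X \<and> letter_pre a P \<noteq> {}}"
    unfolding Krieger_vertices_def pasts_nonempty_iff[symmetric] pasts_case_nat[OF assms]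
    using pasts_nonempty_iff[of X] by auto
  then show ?thesis by (simp add: left_Krieger_cover_def past_cover_def)
qed

text \<open>A shift space is closed, hence so is every set of pasts; closedness is stated through the finite
  final segments of left rays.\<close>

lemma Krieger_vertex_limit:
  assumes "shift_space A X" "P \<in> Krieger_vertices X" "\<And>n. \<exists>y'\<in>P. \<forall>i<n. y' i = y i"
  shows "y \<in> P"
proof -
  obtain x where x: "P = pasts X x" using assms(2) unfolding Krieger_vertices_def by blast
  have "\<exists>z'\<in>X. agree n (glue y x) z'" for n
  proof -
    obtain y' where y': "y' \<in> P" "\<forall>i<n. y' i = y i" using assms(3) by blast
    have "agree n (glue y x) (glue y' x)"
      using y'(2) by (auto simp: agree_def glue_def)
    then show ?thesis using y'(1) unfolding x mem_pasts_iff by blast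
  qed
  then show ?thesis unfolding x mem_pasts_iff by (rule closed_limit[OF assms(1)])
qed

lemma Krieger_vertex_letter:
  assumes "shift_space A X" "P \<in> Krieger_vertices X" "y \<in> P"
  shows "y n \<in> A"
proof -
  obtain x where x: "glue y x \<in> X"
    using assms(2,3) mem_pasts_iff unfolding Krieger_vertices_def by blast
  have "glue y x (- 1 - int n) = y n" by (simp add: glue_def)
  moreover have "range (glue y x) \<subseteq> A"
    using assms(1) x closedin_full_shift_range unfolding shift_space_def by blast
  ultimately show ?thesis by (metis range_subsetD)
qed

section \<open>Label sequences of left-infinite paths\<close>

lemma letter_pre_vertex_pasts:
  "letter_pre a (vertex_pasts E L v) = \<Union> (vertex_pasts E L ` label_pre E L a {v})"
proof
  show "letter_pre a (vertex_pasts E L v) \<subseteq> \<Union> (vertex_pasts E L ` label_pre E L a {v})"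
  proof
    fix y assume "y \<in> letter_pre a (vertex_pasts E L v)"
    then obtain p where p: "case_nat a y = (\<lambda>n. L (p n))" "\<And>n. p n \<in> arcs E"
        "head E (p 0) = v" "\<And>n. head E (p (Suc n)) = tail E (p n)"
      unfolding letter_pre_def vertex_pasts_def by blast
    have "a = L (p 0)" using fun_cong[OF p(1), of 0] by simp
    moreover have y: "y n = L (p (Suc n))" for n using fun_cong[OF p(1), of "Suc n"] by simp
    ultimately have "tail E (p 0) \<in> label_pre E L a {v}"
      using p unfolding label_pre_def by blast
    moreover have "y \<in> vertex_pasts E L (tail E (p 0))"
      unfolding vertex_pasts_def using y p by (intro CollectI exI[of _ "\<lambda>n. p (Suc n)"]) auto
    ultimately show "y \<in> \<Union> (vertex_pasts E L ` label_pre E L a {v})" by blast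
  qed
  show "\<Union> (vertex_pasts E L ` label_pre E L a {v}) \<subseteq> letter_pre a (vertex_pasts E L v)"
  proof
    fix y assume "y \<in> \<Union> (vertex_pasts E L ` label_pre E L a {v})"
    then obtain e p where e: "e \<in> arcs E" "L e = a" "head E e = v"
      and p: "y = (\<lambda>n. L (p n))" "\<And>n. p n \<in> arcs E"
        "head E (p 0) = tail E e" "\<And>n. head E (p (Suc n)) = tail E (p n)"
      unfolding label_pre_def vertex_pasts_def by auto
    have "case_nat a y = (\<lambda>n. L (case_nat e p n))"
      using e p by (auto simp: fun_eq_iff split: nat.split)
    moreover have "case_nat e p n \<in> arcs E" for n
      using e p by (simp split: nat.split)
    moreover have "head E (case_nat e p (Suc n)) = tail E (case_nat e p n)" for n
      using p by (simp split: nat.split)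
    moreover have "head E (case_nat e p 0) = v" using e by simp
    ultimately show "y \<in> letter_pre a (vertex_pasts E L v)"
      unfolding letter_pre_def vertex_pasts_def by blast
  qed
qed

lemma vertex_pasts_iso:
  assumes h: "pre_digraph.digraph_isomorphism E h"
    and lab: "\<And>e. e \<in> arcs E \<Longrightarrow> M (iso_arcs h e) = L e" and v: "v \<in> verts E"
  shows "vertex_pasts (app_iso h E) M (iso_verts h v) = vertex_pasts E L v"
proof -
  have wf: "wf_digraph E" and inj: "inj_on (iso_verts h) (verts E)"
    and tl: "\<And>e. e \<in> arcs E \<Longrightarrow> iso_tail h (iso_arcs h e) = iso_verts h (tail E e)"
    and hd: "\<And>e. e \<in> arcs E \<Longrightarrow> iso_head h (iso_arcs h e) = iso_verts h (head E e)"
    using h unfolding pre_digraph.digraph_isomorphism_def by auto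
  have vtl: "tail E e \<in> verts E" and vhd: "head E e \<in> verts E" if "e \<in> arcs E" for e
    using wf that by (auto simp: wf_digraph_def)
  show ?thesis
  proof
    show "vertex_pasts (app_iso h E) M (iso_verts h v) \<subseteq> vertex_pasts E L v"
    proof
      fix y assume "y \<in> vertex_pasts (app_iso h E) M (iso_verts h v)"
      then obtain q where q: "y = (\<lambda>n. M (q n))" "\<And>n. q n \<in> iso_arcs h ` arcs E"
          "iso_head h (q 0) = iso_verts h v" "\<And>n. iso_head h (q (Suc n)) = iso_tail h (q n)"
        unfolding vertex_pasts_def by auto
      have "\<forall>n. \<exists>e. e \<in> arcs E \<and> q n = iso_arcs h e" using q(2) by blast
      then obtain p where p: "\<And>n. p n \<in> arcs E" "\<And>n. q n = iso_arcs h (p n)" by metis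
      have "head E (p 0) = v"
        using q(3) p hd vhd v inj by (metis inj_onD)
      moreover have "head E (p (Suc n)) = tail E (p n)" for n
        using q(4)[of n] p hd tl vhd vtl inj by (metis inj_onD)
      moreover have "y = (\<lambda>n. L (p n))" using q(1) p lab by simp
      ultimately show "y \<in> vertex_pasts E L v" using p(1) unfolding vertex_pasts_def by blast
    qed
    show "vertex_pasts E L v \<subseteq> vertex_pasts (app_iso h E) M (iso_verts h v)"
    proof
      fix y assume "y \<in> vertex_pasts E L v"
      then obtain p where p: "y = (\<lambda>n. L (p n))" "\<And>n. p n \<in> arcs E"
        "head E (p 0) = v" "\<And>n. head E (p (Suc n)) = tail E (p n)"
        unfolding vertex_pasts_def by blast
      show "y \<in> vertex_pasts (app_iso h E) M (iso_verts h v)"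
        unfolding vertex_pasts_def
        by (intro CollectI exI[of _ "\<lambda>n. iso_arcs h (p n)"]) (simp add: p lab hd tl)
    qed
  qed
qed

text \<open>The set of vertices from which a path labelled \<open>y\<^bsub>n-1\<^esub> \<dots> y\<^bsub>0\<^esub>\<close> leads into \<open>V\<close>.\<close>

primrec word_pre ::
    "('v, 'e) pre_digraph \<Rightarrow> ('e \<Rightarrow> 'a) \<Rightarrow> (nat \<Rightarrow> 'a) \<Rightarrow> 'v set \<Rightarrow> nat \<Rightarrow> 'v set" where
  "word_pre E L y V 0 = V"
| "word_pre E L y V (Suc n) = label_pre E L (y n) (word_pre E L y V n)"

lemma label_pre_UN: "label_pre E L a (\<Union>i\<in>I. V i) = (\<Union>i\<in>I. label_pre E L a (V i))"
  by (auto simp: label_pre_def)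

lemma word_pre_UN: "word_pre E L y V n = (\<Union>v\<in>V. word_pre E L y {v} n)"
  by (induction n) (auto simp: label_pre_UN)

lemma word_pre_empty_mono:
  assumes "word_pre E L y V m = {}" "m \<le> n"
  shows "word_pre E L y V n = {}"
  using assms(2) by (induction n rule: dec_induct) (simp_all add: assms(1) label_pre_def)

text \<open>A compactness argument. As \<open>V\<close> is finite, one vertex \<open>v\<close> of it is the end of paths for all finite
  segments of \<open>y\<close>. In a left-resolving graph such a path is determined by its range and its labels,
  so the paths for growing segments extend each other and form one left-infinite path.\<close>

lemma word_pre_nonempty_imp_vertex_pasts:
  assumes lr: "left_resolving E L" and fin: "finite V" and ne: "\<And>n. word_pre E L y V n \<noteq> {}"
  shows "\<exists>v\<in>V. y \<in> vertex_pasts E L v"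
proof -
  obtain v where v: "v \<in> V" "\<And>n. word_pre E L y {v} n \<noteq> {}"
  proof (rule ccontr)
    assume "\<not> thesis"
    then have "\<forall>v\<in>V. \<exists>n. word_pre E L y {v} n = {}" using that by blast
    then obtain N where N: "\<And>v. v \<in> V \<Longrightarrow> word_pre E L y {v} (N v) = {}" by metis
    have "word_pre E L y {v} (\<Sum>u\<in>V. N u) = {}" if "v \<in> V" for v
      by (rule word_pre_empty_mono[OF N[OF that]]) (use fin that in \<open>simp add: member_le_sum\<close>)
    then have "word_pre E L y V (\<Sum>u\<in>V. N u) = {}" by (subst word_pre_UN) simp
    then show False using ne by blast
  qed
  have "\<exists>u. word_pre E L y {v} n \<subseteq> {u}" for n
  proof (induction n)
    case 0
    then show ?case by auto
  next
    case (Suc n)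
    then obtain u where "word_pre E L y {v} n \<subseteq> {u}" by blast
    have "w = w'"
      if w: "w \<in> word_pre E L y {v} (Suc n)" "w' \<in> word_pre E L y {v} (Suc n)" for w w'
    proof -
      have "\<exists>e\<in>arcs E. L e = y n \<and> head E e = u \<and> tail E e = x"
        if "x \<in> word_pre E L y {v} (Suc n)" for x
        using that \<open>word_pre E L y {v} n \<subseteq> {u}\<close> by (auto simp: label_pre_def)
      from this[OF w(1)] this[OF w(2)] lr show ?thesis
        unfolding left_resolving_def by metis
    qed
    then show ?case by blast
  qed
  then have "\<forall>n. \<exists>u. word_pre E L y {v} n = {u}" using v(2) by (metis subset_singletonD)
  then obtain u where u: "\<And>n. word_pre E L y {v} n = {u n}" by metis
  have "\<forall>n. \<exists>e. e \<in> arcs E \<and> L e = y n \<and> head E e = u n \<and> tail E e = u (Suc n)"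
  proof
    fix n
    have "u (Suc n) \<in> label_pre E L (y n) {u n}" using u[of "Suc n"] u[of n] by simp
    then show "\<exists>e. e \<in> arcs E \<and> L e = y n \<and> head E e = u n \<and> tail E e = u (Suc n)"
      by (auto simp: label_pre_def)
  qed
  then obtain p where p: "\<And>n. p n \<in> arcs E \<and> L (p n) = y n \<and> head E (p n) = u n \<and>
      tail E (p n) = u (Suc n)" by metis
  have "u 0 = v" using u[of 0] by simp
  then have "y \<in> vertex_pasts E L v"
    unfolding vertex_pasts_def using p by (intro CollectI exI[of _ p]) simp
  then show ?thesis using v(1) by blast
qed

text \<open>The link between the class graph and the graph below it. Reading a label sequence backwards from
  the class of \<open>V\<close> passes through the classes of the sets \<open>word_pre E L y V n\<close>, whatever
  representatives the arcs were built from; the reading never stops exactly if all these sets are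
  nonempty.\<close>

lemma vertex_pasts_class_graph:
  assumes pc: "past_closed E L S R" and lr: "left_resolving E L" and fin: "finite (verts E)"
    and V: "V \<in> S"
  shows "vertex_pasts (class_graph E L S R) triple_label (R `` {V}) = \<Union> (vertex_pasts E L ` V)"
proof -
  have sub: "\<And>W. W \<in> S \<Longrightarrow> W \<subseteq> verts E \<and> W \<noteq> {}" and eq: "equiv S R"
    and preS: "\<And>W a. W \<in> S \<Longrightarrow> label_pre E L a W \<noteq> {} \<Longrightarrow> label_pre E L a W \<in> S"
    and preR: "\<And>U W a. U \<in> S \<Longrightarrow> W \<in> S \<Longrightarrow> (U, W) \<in> R \<Longrightarrow> label_pre E L a U \<noteq> {} \<Longrightarrow>
      label_pre E L a W \<noteq> {} \<and> (label_pre E L a U, label_pre E L a W) \<in> R"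
    using pc unfolding past_closed_def by blast+
  have arcs: "arcs (class_graph E L S R) =
      {(R `` {label_pre E L a W}, a, R `` {W}) |a W. W \<in> S \<and> label_pre E L a W \<noteq> {}}"
    and hd: "head (class_graph E L S R) = (\<lambda>(u, a, w). w)"
    and tl: "tail (class_graph E L S R) = (\<lambda>(u, a, w). u)"
    by (simp_all add: class_graph_def triple_graph_def)
  show ?thesis
  proof
    show "vertex_pasts (class_graph E L S R) triple_label (R `` {V}) \<subseteq> \<Union> (vertex_pasts E L ` V)"
    proof
      fix y assume "y \<in> vertex_pasts (class_graph E L S R) triple_label (R `` {V})"
      then obtain p where y: "y = (\<lambda>n. triple_label (p n))"
        and p: "\<And>n. p n \<in> arcs (class_graph E L S R)"
        and p0: "head (class_graph E L S R) (p 0) = R `` {V}"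
        and pS: "\<And>n. head (class_graph E L S R) (p (Suc n)) = tail (class_graph E L S R) (p n)"
        unfolding vertex_pasts_def by blast
      have "word_pre E L y V n \<in> S \<and>
            head (class_graph E L S R) (p n) = R `` {word_pre E L y V n}" for n
      proof (induction n)
        case 0
        then show ?case using V p0 by simp
      next
        case (Suc n)
        obtain a W where W: "W \<in> S" "label_pre E L a W \<noteq> {}"
          and pn: "p n = (R `` {label_pre E L a W}, a, R `` {W})"
          using p[of n] unfolding arcs by blast
        have a: "a = y n" unfolding y by (simp add: pn triple_label_def)
        have "R `` {W} = R `` {word_pre E L y V n}" using Suc pn by (simp add: hd)
        then have "(W, word_pre E L y V n) \<in> R"
          using eq W(1) Suc by (simp add: eq_equiv_class_iff)
        from preR[OF W(1) _ this W(2)] Suc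
        have "label_pre E L a (word_pre E L y V n) \<noteq> {}"
          "(label_pre E L a W, word_pre E L y V (Suc n)) \<in> R" by (simp_all add: a)
        then have "word_pre E L y V (Suc n) \<in> S"
          "R `` {label_pre E L a W} = R `` {word_pre E L y V (Suc n)}"
          using preS[of "word_pre E L y V n" a] Suc eq by (simp_all add: a equiv_class_eq)
        then show ?case using pS[of n] by (simp add: pn tl)
      qed
      then have "\<And>n. word_pre E L y V n \<noteq> {}" using sub by blast
      then have "\<exists>v\<in>V. y \<in> vertex_pasts E L v"
        using word_pre_nonempty_imp_vertex_pasts[OF lr] sub[OF V] fin finite_subset by blast
      then show "y \<in> \<Union> (vertex_pasts E L ` V)" by blast
    qed
    show "\<Union> (vertex_pasts E L ` V) \<subseteq> vertex_pasts (class_graph E L S R) triple_label (R `` {V})"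
    proof
      fix y assume "y \<in> \<Union> (vertex_pasts E L ` V)"
      then obtain v p where v: "v \<in> V" and p: "y = (\<lambda>n. L (p n))" "\<And>n. p n \<in> arcs E"
        "head E (p 0) = v" "\<And>n. head E (p (Suc n)) = tail E (p n)"
        unfolding vertex_pasts_def by blast
      have hd_mem: "head E (p n) \<in> word_pre E L y V n" for n
      proof (induction n)
        case 0
        then show ?case using v p by simp
      next
        case (Suc n)
        then show ?case using p(1,2) unfolding p(4) by (auto simp: label_pre_def)
      qed
      have ne: "label_pre E L (y n) (word_pre E L y V n) \<noteq> {}" for n
        using hd_mem[of "Suc n"] by auto
      have inS: "word_pre E L y V n \<in> S" for n
        by (induction n) (use V preS ne in auto)
      define q where "q n = (R `` {word_pre E L y V (Suc n)}, y n, R `` {word_pre E L y V n})" for n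
      have "q n \<in> arcs (class_graph E L S R)" for n
        unfolding arcs q_def using ne[of n] inS[of n] by auto
      moreover have "head (class_graph E L S R) (q 0) = R `` {V}"
        "\<And>n. head (class_graph E L S R) (q (Suc n)) = tail (class_graph E L S R) (q n)"
        by (simp_all add: q_def hd tl)
      moreover have "y = (\<lambda>n. triple_label (q n))" by (simp add: q_def triple_label_def)
      ultimately show "y \<in> vertex_pasts (class_graph E L S R) triple_label (R `` {V})"
        unfolding vertex_pasts_def by blast
    qed
  qed
qed

section \<open>Finite families of closed sets of left rays\<close>

lemma label_pre_past_cover:
  assumes "V \<subseteq> \<P>"
  shows "label_pre (past_cover \<P>) triple_label a V = letter_pre a ` V - {{}}"
proof
  show "label_pre (past_cover \<P>) triple_label a V \<subseteq> letter_pre a ` V - {{}}"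
    by (auto simp: label_pre_def arcs_past_cover triple_label_def)
  show "letter_pre a ` V - {{}} \<subseteq> label_pre (past_cover \<P>) triple_label a V"
  proof
    fix Q assume "Q \<in> letter_pre a ` V - {{}}"
    then obtain P where P: "P \<in> V" "Q = letter_pre a P" "Q \<noteq> {}" by blast
    then have "(Q, a, P) \<in> arcs (past_cover \<P>)" using assms unfolding arcs_past_cover by blast
    moreover have "Q = tail (past_cover \<P>) (Q, a, P)" by simp
    ultimately show "Q \<in> label_pre (past_cover \<P>) triple_label a V"
      unfolding label_pre_def using P(1) by (intro image_eqI) (auto simp: triple_label_def)
  qed
qed

text \<open>The properties of the vertex set of the Krieger cover of a sofic shift that are used below. They
  pass to every subfamily closed under \<open>letter_pre\<close>, in particular to the vertices of the generalized
  Fischer cover, so that one lemma serves both covers.\<close>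

locale past_family =
  fixes A :: "'a set" and \<P> :: "(nat \<Rightarrow> 'a) set set"
  assumes finite_alphabet: "finite A"
    and finite_family: "finite \<P>"
    and nonempty: "P \<in> \<P> \<Longrightarrow> P \<noteq> {}"
    and letters: "P \<in> \<P> \<Longrightarrow> y \<in> P \<Longrightarrow> y n \<in> A"
    and limit_mem: "P \<in> \<P> \<Longrightarrow> (\<And>n. \<exists>y'\<in>P. \<forall>i<n. y' i = y i) \<Longrightarrow> y \<in> P"
    and letter_pre_mem: "P \<in> \<P> \<Longrightarrow> letter_pre a P \<noteq> {} \<Longrightarrow> letter_pre a P \<in> \<P>"
begin

lemma fin_digraph_past_cover: "fin_digraph (past_cover \<P>)"
proof
  have "arcs (past_cover \<P>) \<subseteq> (\<lambda>(a, P). (letter_pre a P, a, P)) ` (A \<times> \<P>)"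
  proof
    fix e assume "e \<in> arcs (past_cover \<P>)"
    then obtain a P y where e: "e = (letter_pre a P, a, P)" "P \<in> \<P>" "y \<in> letter_pre a P"
      unfolding arcs_past_cover by blast
    have "a \<in> A" using letters[OF e(2), of "case_nat a y" 0] e(3) by (simp add: letter_pre_def)
    then show "e \<in> (\<lambda>(a, P). (letter_pre a P, a, P)) ` (A \<times> \<P>)"
      using e by (intro image_eqI[of _ _ "(a, P)"]) simp_all
  qed
  then show "finite (arcs (past_cover \<P>))"
    by (rule finite_subset) (simp add: finite_alphabet finite_family)
  fix e assume "e \<in> arcs (past_cover \<P>)"
  then obtain a P where "e = (letter_pre a P, a, P)" "P \<in> \<P>" "letter_pre a P \<noteq> {}"
    unfolding arcs_past_cover by blast
  then show "tail (past_cover \<P>) e \<in> verts (past_cover \<P>)"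
    "head (past_cover \<P>) e \<in> verts (past_cover \<P>)"
    by (simp_all add: letter_pre_mem)
qed (simp add: finite_family)

lemma left_resolving_past_cover: "left_resolving (past_cover \<P>) triple_label"
  by (auto simp: left_resolving_def arcs_past_cover triple_label_def)

text \<open>Reading \<open>y\<close> backwards from \<open>P\<close> succeeds for \<open>n\<close> letters exactly if some element of \<open>P\<close> shares its
  last \<open>n\<close> letters with \<open>y\<close>; as \<open>P\<close> is closed, this holds for all \<open>n\<close> only if \<open>y\<close> lies in \<open>P\<close>.\<close>

lemma vertex_pasts_past_cover:
  assumes P: "P \<in> \<P>"
  shows "vertex_pasts (past_cover \<P>) triple_label P = P"
proof
  show "vertex_pasts (past_cover \<P>) triple_label P \<subseteq> P"
  proof
    have prefix: "\<exists>y'\<in>P. \<forall>i<n. y' i = y i"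
      if "y \<in> vertex_pasts (past_cover \<P>) triple_label P" "P \<in> \<P>" for n y P
      using that
    proof (induction n arbitrary: y P)
      case 0
      then show ?case using nonempty by auto
    next
      case (Suc n)
      define t where "t i = y (Suc i)" for i
      have y: "y = case_nat (y 0) t" by (simp add: fun_eq_iff t_def split: nat.split)
      have "t \<in> letter_pre (y 0) (vertex_pasts (past_cover \<P>) triple_label P)"
        using Suc.prems y by (simp add: letter_pre_def)
      then have t: "t \<in> vertex_pasts (past_cover \<P>) triple_label (letter_pre (y 0) P)"
        and ne: "letter_pre (y 0) P \<noteq> {}"
        using Suc.prems by (auto simp: letter_pre_vertex_pasts label_pre_past_cover)
      from Suc.IH[OF t letter_pre_mem[OF Suc.prems(2) ne]]
      obtain t' where t': "case_nat (y 0) t' \<in> P" "\<forall>i<n. t' i = t i"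
        by (auto simp: letter_pre_def)
      have "\<forall>i<Suc n. case_nat (y 0) t' i = y i"
        using t'(2) by (auto simp: t_def split: nat.split)
      then show ?case using t'(1) by blast
    qed
    fix y assume "y \<in> vertex_pasts (past_cover \<P>) triple_label P"
    from limit_mem[OF P prefix[OF this P]] show "y \<in> P" .
  qed
  show "P \<subseteq> vertex_pasts (past_cover \<P>) triple_label P"
  proof
    fix y assume y: "y \<in> P"
    define Q where "Q = rec_nat P (\<lambda>n Q. letter_pre (y n) Q)"
    have Q: "Q 0 = P" "\<And>n. Q (Suc n) = letter_pre (y n) (Q n)" by (simp_all add: Q_def)
    have Qn: "Q n \<in> \<P> \<and> (\<lambda>i. y (n + i)) \<in> Q n" for n
    proof (induction n)
      case 0
      then show ?case using P y by (simp add: Q)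
    next
      case (Suc n)
      have "case_nat (y n) (\<lambda>i. y (Suc n + i)) = (\<lambda>i. y (n + i))"
        by (auto simp: fun_eq_iff split: nat.split)
      then have "(\<lambda>i. y (Suc n + i)) \<in> Q (Suc n)" using Suc by (simp add: Q letter_pre_def)
      then show ?case using letter_pre_mem[of "Q n" "y n"] Suc by (auto simp: Q)
    qed
    have "(Q (Suc n), y n, Q n) \<in> arcs (past_cover \<P>)" for n
      using Qn[of n] Qn[of "Suc n"] nonempty[of "Q (Suc n)"] unfolding arcs_past_cover by (auto simp: Q)
    then show "y \<in> vertex_pasts (past_cover \<P>) triple_label P"
      unfolding vertex_pasts_def
      by (intro CollectI exI[of _ "\<lambda>n. (Q (Suc n), y n, Q n)"]) (simp add: Q triple_label_def)
  qed
qed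

lemma predecessor_separated_past_cover: "predecessor_separated (past_cover \<P>) triple_label"
  by (simp add: predecessor_separated_def vertex_pasts_past_cover)

section \<open>Generating subfamilies are foundations\<close>

text \<open>A set \<open>V\<close> of members of \<open>\<Q>\<close> stands for the past \<open>\<Union>V\<close>. Taking as \<open>S\<close> the sets whose union belongs to
  \<open>\<P>\<close>, and identifying sets with the same union, the classes are in bijection with \<open>\<P>\<close>: every member
  of \<open>\<P>\<close> is such a union. Since \<open>letter_pre\<close> commutes with unions, the arcs correspond as well.\<close>

lemma foundation_past_cover:
  assumes sub: "\<Q> \<subseteq> \<P>"
    and closed: "\<And>a Q. Q \<in> \<Q> \<Longrightarrow> letter_pre a Q \<noteq> {} \<Longrightarrow> letter_pre a Q \<in> \<Q>"
    and gen: "\<And>P. P \<in> \<P> \<Longrightarrow> \<exists>V\<subseteq>\<Q>. P = \<Union> V"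
  shows "foundation (past_cover \<Q>) triple_label (past_cover \<P>) triple_label"
proof -
  interpret Q: past_family A \<Q>
    using finite_alphabet finite_subset[OF sub finite_family] nonempty letters limit_mem closed sub
    by unfold_locales blast+
  define S where "S = {V. V \<subseteq> \<Q> \<and> \<Union> V \<in> \<P>}"
  define R where "R = {(U, V). U \<in> S \<and> V \<in> S \<and> \<Union> U = \<Union> V}"
  have pre: "label_pre (past_cover \<Q>) triple_label a V = letter_pre a ` V - {{}}" if "V \<in> S" for a V
    by (rule label_pre_past_cover) (use that in \<open>simp add: S_def\<close>)
  have Un: "\<Union> (label_pre (past_cover \<Q>) triple_label a V) = letter_pre a (\<Union> V)"
    if "V \<in> S" for a V
    unfolding pre[OF that] letter_pre_Union by auto
  have ne: "label_pre (past_cover \<Q>) triple_label a V \<noteq> {} \<longleftrightarrow> letter_pre a (\<Union> V) \<noteq> {}"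
    if "V \<in> S" for a V
    unfolding pre[OF that] letter_pre_Union by auto
  have preS: "label_pre (past_cover \<Q>) triple_label a V \<in> S"
    if V: "V \<in> S" "label_pre (past_cover \<Q>) triple_label a V \<noteq> {}" for a V
  proof -
    have "label_pre (past_cover \<Q>) triple_label a V \<subseteq> \<Q>"
      unfolding pre[OF V(1)] using V(1) closed by (auto simp: S_def)
    moreover have "letter_pre a (\<Union> V) \<in> \<P>"
      using V ne letter_pre_mem by (simp add: S_def)
    ultimately show ?thesis using Un[OF V(1)] by (simp add: S_def)
  qed
  have eq: "equiv S R"
    by (intro equivI refl_onI symI transI) (auto simp: R_def)
  have pc: "past_closed (past_cover \<Q>) triple_label S R"
    unfolding past_closed_def
  proof (intro conjI ballI allI impI)
    show "S \<subseteq> Pow (verts (past_cover \<Q>)) - {{}}" using nonempty by (auto simp: S_def)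
    show "{v} \<in> S" if "v \<in> verts (past_cover \<Q>)" for v
      using that sub by (auto simp: S_def)
    show "u = v" if "({u}, {v}) \<in> R" for u v using that by (simp add: R_def)
    show "label_pre (past_cover \<Q>) triple_label a V \<in> S"
      if "V \<in> S" "label_pre (past_cover \<Q>) triple_label a V \<noteq> {}" for a V using preS that .
    fix U V a
    assume UV: "U \<in> S" "V \<in> S" "(U, V) \<in> R \<and> label_pre (past_cover \<Q>) triple_label a U \<noteq> {}"
    then have UnUV: "\<Union> U = \<Union> V" by (simp add: R_def)
    then show ne': "label_pre (past_cover \<Q>) triple_label a V \<noteq> {}"
      using UV ne[OF UV(1)] ne[OF UV(2)] by simp
    show "(label_pre (past_cover \<Q>) triple_label a U, label_pre (past_cover \<Q>) triple_label a V) \<in> R"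
      using UV ne' preS Un UnUV by (simp add: R_def)
  qed (rule eq)
  define cls where "cls P = {V \<in> S. \<Union> V = P}" for P
  have cls_ne: "cls P \<noteq> {}" if "P \<in> \<P>" for P
    using gen[OF that] that by (auto simp: cls_def S_def)
  have inj: "inj_on cls \<P>"
  proof (rule inj_onI)
    fix P P' assume P: "P \<in> \<P>" "P' \<in> \<P>" "cls P = cls P'"
    then obtain V where "V \<in> cls P" "V \<in> cls P'" using cls_ne by blast
    then show "P = P'" by (simp add: cls_def)
  qed
  have R_cls: "R `` {V} = cls (\<Union> V)" if "V \<in> S" for V
    using that by (auto simp: R_def cls_def)
  have quot: "S // R = cls ` \<P>"
  proof
    show "S // R \<subseteq> cls ` \<P>" by (auto simp: quotient_def R_cls) (auto simp: S_def)
    show "cls ` \<P> \<subseteq> S // R"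
    proof
      fix c assume "c \<in> cls ` \<P>"
      then obtain P V where "c = cls P" "V \<in> S" "\<Union> V = P" using cls_ne by (force simp: cls_def)
      then show "c \<in> S // R" using R_cls by (auto simp: quotient_def)
    qed
  qed
  define h where "h = \<lparr>iso_verts = cls, iso_arcs = (\<lambda>(P, a :: 'a, Q). (cls P, a, cls Q)),
    iso_head = (\<lambda>(u, a, v). v), iso_tail = (\<lambda>(u, a, v). u)\<rparr>"
  have "{(R `` {label_pre (past_cover \<Q>) triple_label a V}, a, R `` {V}) |a V.
           V \<in> S \<and> label_pre (past_cover \<Q>) triple_label a V \<noteq> {}} =
        {(cls (letter_pre a P), a, cls P) |a P. P \<in> \<P> \<and> letter_pre a P \<noteq> {}}" (is "?L = ?R")
  proof
    show "?L \<subseteq> ?R"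
    proof
      fix e assume "e \<in> ?L"
      then obtain a V where V: "V \<in> S" "label_pre (past_cover \<Q>) triple_label a V \<noteq> {}"
        and e: "e = (R `` {label_pre (past_cover \<Q>) triple_label a V}, a, R `` {V})" by blast
      have "e = (cls (letter_pre a (\<Union> V)), a, cls (\<Union> V))"
        unfolding e R_cls[OF V(1)] R_cls[OF preS[OF V]] Un[OF V(1)] ..
      moreover have "\<Union> V \<in> \<P>" using V(1) by (simp add: S_def)
      moreover have "letter_pre a (\<Union> V) \<noteq> {}" using ne[OF V(1)] V(2) by blast
      ultimately show "e \<in> ?R" by blast
    qed
    show "?R \<subseteq> ?L"
    proof
      fix e assume "e \<in> ?R"
      then obtain a P where P: "P \<in> \<P>" "letter_pre a P \<noteq> {}"
        and e: "e = (cls (letter_pre a P), a, cls P)" by blast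
      obtain V where V: "V \<in> S" "\<Union> V = P" using cls_ne[OF P(1)] by (auto simp: cls_def)
      have ne': "label_pre (past_cover \<Q>) triple_label a V \<noteq> {}" using ne[OF V(1)] V(2) P(2) by simp
      have "e = (R `` {label_pre (past_cover \<Q>) triple_label a V}, a, R `` {V})"
        unfolding e R_cls[OF V(1)] R_cls[OF preS[OF V(1) ne']] Un[OF V(1)] V(2) ..
      then show "e \<in> ?L" using V(1) ne' by blast
    qed
  qed
  also have "\<dots> = iso_arcs h ` arcs (past_cover \<P>)"
    unfolding arcs_past_cover h_def by (auto simp: image_iff) blast
  finally have graph: "class_graph (past_cover \<Q>) triple_label S R = app_iso h (past_cover \<P>)"
    by (simp add: class_graph_def triple_graph_def app_iso_def quot) (simp add: h_def)
  have wf: "wf_digraph (past_cover \<P>)"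
    using fin_digraph_past_cover by (rule fin_digraph.axioms(1))
  have "pre_digraph.digraph_isomorphism (past_cover \<P>) h"
    unfolding pre_digraph.digraph_isomorphism_def
  proof (intro conjI)
    show "wf_digraph (past_cover \<P>)" by (rule wf)
    show "inj_on (iso_verts h) (verts (past_cover \<P>))" using inj by (simp add: h_def)
    show "inj_on (iso_arcs h) (arcs (past_cover \<P>))"
      by (rule inj_onI) (auto simp: h_def arcs_past_cover dest: inj_onD[OF inj])
  qed (auto simp: h_def)
  then have "labelled_graph_iso (past_cover \<P>) triple_label
      (class_graph (past_cover \<Q>) triple_label S R) triple_label"
    unfolding labelled_graph_iso_def graph
    by (intro exI[of _ h]) (auto simp: h_def triple_label_def)
  then show ?thesis
    unfolding foundation_def
    using Q.fin_digraph_past_cover Q.left_resolving_past_cover Q.predecessor_separated_past_cover pc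
    by blast
qed

definition indecomposable :: "(nat \<Rightarrow> 'a) set \<Rightarrow> bool" where
  "indecomposable P \<longleftrightarrow> P \<in> \<P> \<and> (\<forall>V\<subseteq>\<P>. P = \<Union> V \<longrightarrow> P \<in> V)"

definition core :: "(nat \<Rightarrow> 'a) set set" where
  "core = {P \<in> \<P>. \<exists>P'. indecomposable P' \<and> P \<rightarrow>\<^sup>*\<^bsub>past_cover \<P>\<^esub> P'}"

text \<open>A decomposable member is the union of strictly smaller ones, and the family is finite.\<close>

lemma Union_of_indecomposables: "P \<in> \<P> \<Longrightarrow> P = \<Union> {Q. indecomposable Q \<and> Q \<subseteq> P}"
proof (induction "card {Q \<in> \<P>. Q \<subset> P}" arbitrary: P rule: less_induct)
  case less
  have "\<exists>Q. indecomposable Q \<and> Q \<subseteq> P \<and> y \<in> Q" if y: "y \<in> P" for y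
  proof (cases "indecomposable P")
    case True
    then show ?thesis using y by blast
  next
    case False
    then obtain V where V: "V \<subseteq> \<P>" "P = \<Union> V" "P \<notin> V"
      using less.prems unfolding indecomposable_def by blast
    obtain Q where Q: "Q \<in> V" "y \<in> Q" using y unfolding V(2) by blast
    have "Q \<subset> P" using V(2,3) Q(1) by blast
    moreover have "Q \<in> \<P>" using V(1) Q(1) by blast
    ultimately have "{Q' \<in> \<P>. Q' \<subset> Q} \<subset> {Q' \<in> \<P>. Q' \<subset> P}" by blast
    then have "card {Q' \<in> \<P>. Q' \<subset> Q} < card {Q' \<in> \<P>. Q' \<subset> P}"
      by (intro psubset_card_mono) (simp add: finite_family)
    from less.hyps[OF this \<open>Q \<in> \<P>\<close>] Q(2)
    obtain Q' where "indecomposable Q'" "Q' \<subseteq> Q" "y \<in> Q'" by blast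
    then show ?thesis using \<open>Q \<subset> P\<close> by blast
  qed
  then show ?case by blast
qed

lemma indecomposable_in_core: "indecomposable P \<Longrightarrow> P \<in> core"
  unfolding core_def indecomposable_def reachable_def by auto

lemma core_letter_pre:
  assumes "P \<in> core" "letter_pre a P \<noteq> {}"
  shows "letter_pre a P \<in> core"
proof -
  have P: "P \<in> \<P>" using assms(1) by (simp add: core_def)
  have "(letter_pre a P, P) \<in> arcs_ends (past_cover \<P>)"
    unfolding arcs_ends_conv
    by (rule image_eqI[of _ _ "(letter_pre a P, a, P)"]) (use P assms(2) in \<open>auto simp: arcs_past_cover\<close>)
  then show ?thesis
    using assms letter_pre_mem[OF P assms(2)]
    by (auto simp: core_def reachable_def intro: converse_rtrancl_on_into_rtrancl_on)
qed

lemma foundation_core: "foundation (past_cover core) triple_label (past_cover \<P>) triple_label"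
proof (rule foundation_past_cover)
  show "core \<subseteq> \<P>" by (auto simp: core_def)
  show "\<exists>V\<subseteq>core. P = \<Union> V" if "P \<in> \<P>" for P
  proof (intro exI conjI)
    show "{Q. indecomposable Q \<and> Q \<subseteq> P} \<subseteq> core" using indecomposable_in_core by blast
  qed (rule Union_of_indecomposables[OF that])
qed (rule core_letter_pre)

end

section \<open>No proper subgraph of the core is a foundation\<close>

lemma shrinking_surjection_eq_id:
  assumes fin: "finite \<Q>" and surj: "\<Q> \<subseteq> g ` \<Q>" and sub: "\<And>Q. Q \<in> \<Q> \<Longrightarrow> g Q \<subseteq> Q"
    and Q: "Q \<in> \<Q>"
  shows "g Q = Q"
proof (rule ccontr)
  assume "g Q \<noteq> Q"
  then have "{Q \<in> \<Q>. g Q \<noteq> Q} \<noteq> {}" (is "?D \<noteq> {}") using Q by blast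
  then obtain Q where D: "Q \<in> ?D" and maximal: "\<And>Q'. Q' \<in> ?D \<Longrightarrow> Q \<subseteq> Q' \<Longrightarrow> Q = Q'"
    using finite_has_maximal[of ?D] fin by auto
  \<comment> \<open>The maximal moved set is the image of a larger set, which is moved too.\<close>
  obtain Q' where Q': "Q' \<in> \<Q>" "g Q' = Q" using D surj by blast
  then have "Q \<subseteq> Q'" using sub by blast
  have "Q \<noteq> Q'" using D Q'(2) by (metis (mono_tags, lifting) mem_Collect_eq)
  then have "Q' \<in> ?D" using Q' by (metis (mono_tags, lifting) mem_Collect_eq)
  from maximal[OF this \<open>Q \<subseteq> Q'\<close>] \<open>Q \<noteq> Q'\<close> show False by blast
qed

context past_family
begin

lemma core_subset_predecessor_closed:
  assumes ind: "\<And>P. indecomposable P \<Longrightarrow> P \<in> \<Q>"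
    and closed: "\<And>a Q. Q \<in> \<Q> \<Longrightarrow> letter_pre a Q \<noteq> {} \<Longrightarrow> letter_pre a Q \<in> \<Q>"
  shows "core \<subseteq> \<Q>"
proof
  fix P assume "P \<in> core"
  then obtain P' where P': "indecomposable P'"
    and r: "(P, P') \<in> rtrancl_on \<P> (arcs_ends (past_cover \<P>))"
    by (auto simp: core_def reachable_def)
  from r show "P \<in> \<Q>"
  proof (induction rule: converse_rtrancl_on_induct)
    case base
    then show ?case using ind P' by blast
  next
    case (step Q Q')
    then show ?case using closed by (auto simp: arcs_ends_conv arcs_past_cover)
  qed
qed

text \<open>An isomorphism preserves the label sequences that lead to a vertex, and those leading to \<open>P\<close> in the
  cover of \<open>\<P>\<close> form \<open>P\<close> itself. So the class of \<open>V\<close> corresponds to the union of the pasts of the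
  vertices in \<open>V\<close>, where singletons \<open>V\<close> give the first claim.\<close>

lemma vertex_pasts_foundation:
  assumes H: "foundation H M (past_cover \<P>) triple_label"
  shows "v \<in> verts H \<Longrightarrow> vertex_pasts H M v \<in> \<P>"
    and "P \<in> \<P> \<Longrightarrow> \<exists>V\<subseteq>verts H. P = \<Union> (vertex_pasts H M ` V)"
proof -
  obtain S R h where fin: "fin_digraph H" and lr: "left_resolving H M"
    and pc: "past_closed H M S R"
    and iso: "pre_digraph.digraph_isomorphism (past_cover \<P>) h"
    and img: "class_graph H M S R = app_iso h (past_cover \<P>)"
    and lab: "\<And>e. e \<in> arcs (past_cover \<P>) \<Longrightarrow> triple_label (iso_arcs h e) = triple_label e"
    using H unfolding foundation_def labelled_graph_iso_def by blast
  have finH: "finite (verts H)" using fin by (rule fin_digraph.finite_verts)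
  have verts: "S // R = iso_verts h ` \<P>"
  proof -
    have "verts (class_graph H M S R) = S // R" by (simp add: class_graph_def triple_graph_def)
    then show ?thesis by (simp add: img)
  qed
  have pasts: "P = \<Union> (vertex_pasts H M ` V)" if "P \<in> \<P>" "V \<in> S" "iso_verts h P = R `` {V}" for P V
    using vertex_pasts_class_graph[OF pc lr finH that(2)] that(1)
      vertex_pasts_iso[where M = triple_label and L = triple_label, OF iso lab, of P] vertex_pasts_past_cover
    by (simp add: img that(3)[symmetric])
  show "vertex_pasts H M v \<in> \<P>" if v: "v \<in> verts H"
  proof -
    have "{v} \<in> S" using pc v by (simp add: past_closed_def)
    then have "R `` {{v}} \<in> iso_verts h ` \<P>" unfolding verts[symmetric] by (rule quotientI)
    then obtain P where "P \<in> \<P>" "iso_verts h P = R `` {{v}}" by auto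
    with pasts[OF this(1) \<open>{v} \<in> S\<close> this(2)] show ?thesis by simp
  qed
  show "\<exists>V\<subseteq>verts H. P = \<Union> (vertex_pasts H M ` V)" if P: "P \<in> \<P>"
  proof -
    have "iso_verts h P \<in> S // R" unfolding verts using P by blast
    then obtain V where V: "V \<in> S" "iso_verts h P = R `` {V}" by (rule quotientE)
    moreover have "V \<subseteq> verts H" using pc V(1) unfolding past_closed_def by blast
    ultimately show ?thesis using pasts[OF P] by blast
  qed
qed

text \<open>The map \<open>g\<close> sends a vertex of the subgraph \<open>H\<close> to its set of pasts in \<open>H\<close>, a member of \<open>\<P>\<close> contained in
  the vertex. Its image contains the indecomposable members, because each of them is a union of
  values of \<open>g\<close>, and it is closed under \<open>letter_pre\<close>, because \<open>H\<close> is left-resolving. Hence the image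
  contains \<open>core\<close>, and counting shows that \<open>H\<close> has all vertices. Then \<open>g\<close> is a surjection of the core
  that only shrinks sets, so it is the identity, and no arc into a vertex can be missing without
  making the pasts of that vertex smaller.\<close>

lemma foundation_subgraph_of_core_eq:
  assumes sub: "labelled_subgraph H M (past_cover core) triple_label"
    and H: "foundation H M (past_cover \<P>) triple_label"
  shows "H = past_cover core"
proof -
  have Hsub: "verts H \<subseteq> core" "arcs H \<subseteq> arcs (past_cover core)"
    and ends: "tail H = (\<lambda>(u, a, v). u)" "head H = (\<lambda>(u, a, v). v)" and wfH: "wf_digraph H"
    and lab: "\<And>e. e \<in> arcs H \<Longrightarrow> M e = triple_label e"
    using sub by (auto simp: labelled_subgraph_def subgraph_def compatible_def)
  have core: "core \<subseteq> \<P>" by (auto simp: core_def)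
  have fin: "finite core" using core finite_family by (rule finite_subset)
  interpret core: past_family A core
  proof
    show "P \<in> core \<Longrightarrow> P \<noteq> {}" for P using core nonempty by blast
    show "P \<in> core \<Longrightarrow> y \<in> P \<Longrightarrow> y n \<in> A" for P y n using core letters by blast
    show "y \<in> P" if "P \<in> core" "\<And>n. \<exists>y'\<in>P. \<forall>i<n. y' i = y i" for P y
      using limit_mem[OF subsetD[OF core that(1)] that(2)] .
  qed (rule finite_alphabet fin core_letter_pre; assumption)+
  define g where "g = vertex_pasts H M"
  have g_sub: "g v \<subseteq> v" if v: "v \<in> verts H" for v
  proof -
    have "g v \<subseteq> vertex_pasts (past_cover core) triple_label v"
    proof
      fix y assume "y \<in> g v"
      then obtain p where p: "y = (\<lambda>n. M (p n))" "\<And>n. p n \<in> arcs H"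
        "head H (p 0) = v" "\<And>n. head H (p (Suc n)) = tail H (p n)"
        unfolding g_def vertex_pasts_def by blast
      show "y \<in> vertex_pasts (past_cover core) triple_label v"
        unfolding vertex_pasts_def
        using p Hsub(2) by (intro CollectI exI[of _ p]) (auto simp: lab ends)
    qed
    then show ?thesis using core.vertex_pasts_past_cover Hsub(1) v by blast
  qed
  have lr: "left_resolving H M" using H by (simp add: foundation_def)
  have "core \<subseteq> g ` verts H"
  proof (rule core_subset_predecessor_closed)
    fix P assume P: "indecomposable P"
    then obtain V where V: "V \<subseteq> verts H" "P = \<Union> (g ` V)"
      using vertex_pasts_foundation(2)[OF H, of P] unfolding g_def indecomposable_def by blast
    moreover have "g ` V \<subseteq> \<P>" using vertex_pasts_foundation(1)[OF H] V(1) unfolding g_def by blast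
    ultimately show "P \<in> g ` verts H" using P unfolding indecomposable_def by blast
  next
    fix a Q assume "Q \<in> g ` verts H" and ne: "letter_pre a Q \<noteq> {}"
    then obtain v where v: "v \<in> verts H" "Q = g v" by blast
    have Un: "letter_pre a Q = \<Union> (g ` label_pre H M a {v})"
      unfolding v(2) g_def by (rule letter_pre_vertex_pasts)
    then obtain u where u: "u \<in> label_pre H M a {v}" using ne by blast
    have "u' = u" if "u' \<in> label_pre H M a {v}" for u'
      using u that lr unfolding label_pre_def left_resolving_def by fastforce
    then have "label_pre H M a {v} = {u}" using u by blast
    moreover have "u \<in> verts H"
      using u wfH unfolding label_pre_def by (auto dest: wf_digraph.tail_in_verts)
    ultimately show "letter_pre a Q \<in> g ` verts H" using Un by simp
  qed
  then have "card core \<le> card (verts H)"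
    using surj_card_le[of "verts H" core g] finite_subset[OF Hsub(1) fin] by blast
  then have vertsH: "verts H = core"
    using card_seteq[OF fin Hsub(1)] by blast
  have g_id: "g v = v" if "v \<in> core" for v
    by (rule shrinking_surjection_eq_id[OF fin _ _ that])
      (use \<open>core \<subseteq> g ` verts H\<close> g_sub vertsH in auto)
  have "arcs (past_cover core) \<subseteq> arcs H"
  proof
    fix e assume "e \<in> arcs (past_cover core)"
    then obtain a P where P: "P \<in> core" "letter_pre a P \<noteq> {}" and e: "e = (letter_pre a P, a, P)"
      unfolding arcs_past_cover by blast
    have "letter_pre a (g P) \<noteq> {}" using g_id P by simp
    then have "label_pre H M a {P} \<noteq> {}" unfolding g_def letter_pre_vertex_pasts by blast
    then obtain f where f: "f \<in> arcs H" "M f = a" "head H f = P" unfolding label_pre_def by blast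
    have "f \<in> arcs (past_cover core)" using f Hsub(2) by blast
    then have "f = e"
      using f lab[OF f(1)] unfolding arcs_past_cover e ends by (auto simp: triple_label_def)
    then show "e \<in> arcs H" using f(1) by simp
  qed
  then show ?thesis
    using Hsub(2) by (intro pre_digraph.equality) (auto simp: vertsH ends)
qed

end

section \<open>The covers of a sofic shift\<close>

lemma past_family_Krieger_vertices:
  assumes "sofic A X"
  shows "past_family A (Krieger_vertices X)"
proof -
  have X: "shift_space A X" using assms by (simp add: sofic_def)
  show ?thesis
  proof
    show "finite A" using X by (simp add: shift_space_def)
  qed (use finite_Krieger_vertices[OF assms] Krieger_vertex_nonempty Krieger_vertex_letter[OF X]
        Krieger_vertex_limit[OF X] Krieger_vertices_letter_pre[OF X] in blast)+
qed

theorem theorem4p6: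
  fixes A :: "'a set" and X :: "(int \<Rightarrow> 'a) set"
  assumes "sofic A X"
  shows "foundation (generalized_left_Fischer_cover X) triple_label
           (left_Krieger_cover X) triple_label \<and>
         (\<forall>H M. labelled_subgraph H M (generalized_left_Fischer_cover X) triple_label \<and>
                H \<noteq> generalized_left_Fischer_cover X \<longrightarrow>
                \<not> foundation H M (left_Krieger_cover X) triple_label)"
proof -
  interpret K: past_family A "Krieger_vertices X"
    by (rule past_family_Krieger_vertices[OF assms])
  have Krieger: "left_Krieger_cover X = past_cover (Krieger_vertices X)"
    using assms left_Krieger_cover_eq[of A X] by (simp add: sofic_def)
  have nd: "non_decomposable X = K.indecomposable"
    by (simp add: fun_eq_iff non_decomposable_def K.indecomposable_def)
  have "generalized_left_Fischer_cover X = past_cover (Krieger_vertices X) \<restriction> K.core"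
    by (simp add: generalized_left_Fischer_cover_def Krieger nd K.core_def)
  also have "\<dots> = past_cover K.core"
  proof (rule pre_digraph.equality)
    have "K.core \<subseteq> Krieger_vertices X" by (auto simp: K.core_def)
    then show "arcs (past_cover (Krieger_vertices X) \<restriction> K.core) = arcs (past_cover K.core)"
      by (auto simp: arcs_past_cover dest: K.core_letter_pre)
  qed simp_all
  finally have Fischer: "generalized_left_Fischer_cover X = past_cover K.core" .
  show ?thesis
    unfolding Krieger Fischer using K.foundation_core K.foundation_subgraph_of_core_eq by blast
qed

end
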